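(* Let $m,n\ge 1$ and let $H(z)=\sum_{i=-m}^{n}t_i z^i$ be a Laurent polynomial with complex coefficients, $t_{-m}\neq0$, $t_n\neq 0$. For $x,x'\in\mathbb Z$ and $t>0$ let $$G(x,x';t)=\oint_{|z|=1}\frac{dz}{2\pi i z}\,z^{x-x'}e^{-iH(z)t}$$ (unit circle, counterclockwise). Assume that all saddle points of $H$ are nondegenerate, that no ascending curve of a saddle point ends at another saddle point, and that $H$ has a unique dominant saddle point $z_s$, i.e. $z_s$ is a relevant saddle point and $\operatorname{Im}H(z_s)>\operatorname{Im}H(z'_s)$ for every other relevant saddle point $z_s'$. Then there is a choice of the square root, independent of $t,x,x'$, such that for all fixed $x,x'\in\mathbb Z$, as $t\to+\infty$, $$G(x,x';t)\sim\frac{e^{-iH(z_s)t}}{\sqrt{2\pi i^3z_s^2H''(z_s)\,t}}\;z_s^{x-x'},$$ i.e. the ratio of the two sides tends to $1$.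
   Context: A saddle point (SP) of $H$ is $z_s\in\mathbb C\setminus\{0\}$ with $H'(z_s)=0$; it is nondegenerate if $H''(z_s)\ne0$. From a nondegenerate SP there start exactly two ascending curves $z_\pm(\tau)$, $\tau\ge 0$, of the gradient flow of $\operatorname{Im}H$ (gradient with respect to $(\operatorname{Re}z,\operatorname{Im}z)$), which can be parametrized so that $z_\pm(0)=z_s$ and $H(z_\pm(\tau))=H(z_s)+i\tau$. If they do not end at another SP they exist for all $\tau\ge0$ and each tends to $0$ or to $\infty$. The SP $z_s$ is called relevant if $(|z_+(\tau)|-1)(|z_-(\tau)|-1)<0$ for all large $\tau$ (equivalently, one of the two curves tends to $0$ and the other to $\infty$). The dominant saddle point is the relevant SP with the largest $\operatorname{Im}H$. *)

theory Defs
  imports "HOL-Complex_Analysis.Complex_Analysis" "HOL-Library.Landau_Symbols"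
begin

definition laurent_poly :: "(int \<Rightarrow> complex) \<Rightarrow> nat \<Rightarrow> nat \<Rightarrow> complex \<Rightarrow> complex" where
  "laurent_poly c m n z = (\<Sum>i\<in>{- int m..int n}. c i * z powi i)"

definition green_fun :: "(complex \<Rightarrow> complex) \<Rightarrow> int \<Rightarrow> int \<Rightarrow> real \<Rightarrow> complex" where
  "green_fun H x x' t =
     contour_integral (circlepath 0 1)
       (\<lambda>z. 1 / (2 * of_real pi * \<i> * z) * z powi (x - x') * exp (- \<i> * H z * of_real t))"

definition saddle_point :: "(complex \<Rightarrow> complex) \<Rightarrow> complex \<Rightarrow> bool" where
  "saddle_point H zs \<longleftrightarrow> zs \<noteq> 0 \<and> deriv H zs = 0"

definition nondegenerate :: "(complex \<Rightarrow> complex) \<Rightarrow> complex \<Rightarrow> bool" where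
  "nondegenerate H zs \<longleftrightarrow> deriv (deriv H) zs \<noteq> 0"

(* The times I are either {0..<T} or {0..}. The inner product of type complex is the Euclidean
   one, so GDERIV is the gradient with respect to (Re z, Im z). The factor k > 0 is the
   reparametrization of the flow that achieves H (z tau) = H zs + i tau; that normalization
   excludes tau = 0 from the flow equation, where the speed is infinite. *)
definition ascending_curve ::
    "(complex \<Rightarrow> complex) \<Rightarrow> complex \<Rightarrow> real set \<Rightarrow> (real \<Rightarrow> complex) \<Rightarrow> bool" where
  "ascending_curve H zs I z \<longleftrightarrow>
     continuous_on I z \<and> z 0 = zs \<and>
     (\<forall>\<tau>\<in>I. z \<tau> \<noteq> 0 \<and> H (z \<tau>) = H zs + \<i> * of_real \<tau>) \<and>
     (\<forall>\<tau>\<in>I. \<tau> > 0 \<longrightarrow>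
        (\<exists>g k. GDERIV (\<lambda>w. Im (H w)) (z \<tau>) :> g \<and> k > 0 \<and>
               (z has_vector_derivative k *\<^sub>R g) (at \<tau>)))"

(* A curve from zs to zs' takes finite time, since Im H grows at unit speed along it. *)
definition ascending_curve_ends_at :: "(complex \<Rightarrow> complex) \<Rightarrow> complex \<Rightarrow> complex \<Rightarrow> bool" where
  "ascending_curve_ends_at H zs zs' \<longleftrightarrow>
     (\<exists>T>0. \<exists>z. ascending_curve H zs {0..<T} z \<and> (z \<longlongrightarrow> zs') (at_left T))"

(* The strict inequality forces zp and zm to be different curves, so for a nondegenerate
   saddle point they are the two ascending curves starting there. *)
definition relevant_saddle_point :: "(complex \<Rightarrow> complex) \<Rightarrow> complex \<Rightarrow> bool" where
  "relevant_saddle_point H zs \<longleftrightarrow>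
     saddle_point H zs \<and>
     (\<exists>zp zm. ascending_curve H zs {0..} zp \<and> ascending_curve H zs {0..} zm \<and>
        (\<forall>\<^sub>F \<tau> in at_top. (norm (zp \<tau>) - 1) * (norm (zm \<tau>) - 1) < 0))"

definition unique_dominant_saddle_point :: "(complex \<Rightarrow> complex) \<Rightarrow> complex \<Rightarrow> bool" where
  "unique_dominant_saddle_point H zs \<longleftrightarrow>
     relevant_saddle_point H zs \<and>
     (\<forall>zs'. relevant_saddle_point H zs' \<and> zs' \<noteq> zs \<longrightarrow> Im (H zs) > Im (H zs'))"

end

(* The unit circle is replaced by a contour that passes through the dominant saddle point zs once, in the
   direction of steepest descent, and otherwise stays in {Im H < Im H(zs)}; Laplace's method on the short
   segment at zs then gives the asymptotics.

   The contour comes from a mountain pass argument for the superlevel sets {Im H > h}. As H is a proper map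
   from the punctured plane, it maps each of their components onto the half plane {Im > h}; so each component
   reaches arbitrarily large heights, near 0 or near infinity. Let h' be the largest height at which these
   "inner" and "outer" hills communicate. At a common boundary point of the two at level h' there is a saddle
   point with one ascending curve in each of them, hence a relevant one. So for the dominant saddle point
   the inner and the outer hills above Im H(zs) are disjoint and their closures meet in zs only, and Janiszewski's
   theorem joins the two ends of the steepest descent segment below Im H(zs). The winding number around 0
   of the resulting loop is found by following the two ascending curves of zs: they avoid the loop, start on opposite
   sides of the segment, and run to 0 and to infinity. *)
theory Submission
  imports Defs "HOL-Probability.Distributions" "HOL-Real_Asymp.Real_Asymp"
begin


subsection \<open>Local charts\<close>

text \<open>Saddle points higher than \<open>zs\<close> may exist as long as they are not relevant,
  so the unit circle cannot simply be pushed down along the flow. Connectivity alone decides which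
  saddle points matter: relevance says which hills the two ascending curves climb. Only the piece of
  the contour at \<open>zs\<close> has to be explicit, and even there a short straight segment
  replaces the true steepest descent curve; the rest may be any path strictly below
  \<open>zs\<close>, since its contribution is exponentially smaller. Janiszewski's theorem wants
  one of its two closed sets compact. The closed inner hills are bounded, and adjoining the puncture
  0 to them makes the connecting path avoid 0 too. The orientation of the resulting loop is not
  controlled: its winding number is only known to be 1 or -1. This sign and the direction
  \<open>v\<close> of the segment, of which only \<open>v\<^sup>2\<close> is prescribed by
  \<open>H\<close>, together fix the square root. Both are chosen from \<open>H\<close> alone, hence
  independently of \<open>t\<close>, \<open>x\<close> and \<open>x'\<close>.\<close>

lemma holomorphic_local_chart:
  assumes holf: "f holomorphic_on S" and "open S" "w \<in> S" and "deriv f w \<noteq> 0"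
  obtains N e \<psi> where "open N" "w \<in> N" "N \<subseteq> S" "e > 0"
    "homeomorphism N (ball (f w) e) f \<psi>" "\<psi> holomorphic_on ball (f w) e"
proof -
  obtain r where r: "r > 0" "ball w r \<subseteq> S" "open (f ` ball w r)" "inj_on f (ball w r)"
    using has_complex_derivative_locally_invertible[OF holf \<open>w \<in> S\<close> \<open>open S\<close> assms(4)] by metis
  have holr: "f holomorphic_on ball w r"
    using holf r(2) holomorphic_on_subset by blast
  obtain \<psi> where \<psi>: "\<psi> holomorphic_on f ` ball w r" "\<And>z. z \<in> ball w r \<Longrightarrow> \<psi> (f z) = z"
    using holomorphic_has_inverse[OF holr open_ball r(4)] by metis
  have "f w \<in> f ` ball w r" using r(1) by simp
  \<comment> \<open>The image is cut down to a ball so that half discs and sectors of it are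
    connected and can be carried into the neighbourhood by \<open>\<psi>\<close>.\<close>
  then obtain e where e: "e > 0" "ball (f w) e \<subseteq> f ` ball w r"
    using r(3) openE by metis
  define N where "N = ball w r \<inter> f -` ball (f w) e"
  have contf: "continuous_on (ball w r) f" by (rule holomorphic_on_imp_continuous_on[OF holr])
  show ?thesis
  proof
    show "open N" unfolding N_def
      by (intro continuous_open_preimage contf open_ball)
    show "w \<in> N" using r(1) e(1) by (simp add: N_def)
    show "N \<subseteq> S" using r(2) by (auto simp: N_def)
    show hol\<psi>: "\<psi> holomorphic_on ball (f w) e" using \<psi>(1) e(2) holomorphic_on_subset by blast
    show "homeomorphism N (ball (f w) e) f \<psi>"
      unfolding homeomorphism_def
    proof (intro conjI ballI)
      show fN: "f ` N = ball (f w) e" using e(2) by (auto simp: N_def)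
      show "continuous_on N f" using contf by (rule continuous_on_subset) (auto simp: N_def)
      show "continuous_on (ball (f w) e) \<psi>" by (rule holomorphic_on_imp_continuous_on[OF hol\<psi>])
      show *: "\<psi> (f x) = x" if "x \<in> N" for x using that \<psi>(2) by (auto simp: N_def)
      show "\<psi> ` ball (f w) e = N"
        unfolding fN[symmetric] image_image using * by force
      show "f (\<psi> y) = y" if "y \<in> ball (f w) e" for y
        using that unfolding fN[symmetric] using * by auto
    qed
  qed (rule e(1))
qed

text \<open>In the coordinate \<open>\<phi> z = (z - w) * g z\<close> the function is exactly \<open>f w + \<i> \<phi>\<^sup>2\<close>, so that the
  steepest ascent of the imaginary part runs along the real \<open>\<phi>\<close>-axis.\<close>
definition saddle_chart ::
    "(complex \<Rightarrow> complex) \<Rightarrow> complex \<Rightarrow> complex set \<Rightarrow> real \<Rightarrow> (complex \<Rightarrow> complex) \<Rightarrow> (complex \<Rightarrow> complex) \<Rightarrow> bool" where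
  "saddle_chart f w N e g \<psi> \<longleftrightarrow> open N \<and> w \<in> N \<and> e > 0 \<and> g holomorphic_on N \<and>
     (\<forall>z\<in>N. g z \<noteq> 0) \<and> (\<forall>z\<in>N. f z = f w + \<i> * ((z - w) * g z)\<^sup>2) \<and>
     homeomorphism N (ball 0 e) (\<lambda>z. (z - w) * g z) \<psi> \<and> \<psi> holomorphic_on ball 0 e \<and>
     deriv (deriv f) w = 2 * \<i> * (g w)\<^sup>2"

lemma saddle_chartD:
  assumes "saddle_chart f w N e g \<psi>"
  shows "open N" "w \<in> N" "e > 0" "g holomorphic_on N" "\<And>z. z \<in> N \<Longrightarrow> g z \<noteq> 0"
    "\<And>z. z \<in> N \<Longrightarrow> f z = f w + \<i> * ((z - w) * g z)\<^sup>2"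
    "homeomorphism N (ball 0 e) (\<lambda>z. (z - w) * g z) \<psi>" "\<psi> holomorphic_on ball 0 e"
    "deriv (deriv f) w = 2 * \<i> * (g w)\<^sup>2"
  using assms unfolding saddle_chart_def by blast+

text \<open>\<open>f - f w\<close> vanishes to order exactly two, so it is the square of
  \<open>(z - w) * g0 z\<close> with \<open>g0\<close> free of zeros. A constant factor turns this
  into \<open>\<i>\<close> times a square, and the inverse function theorem makes
  \<open>(z - w) * g z\<close> a coordinate.\<close>

lemma saddle_chart_exists:
  assumes holf: "f holomorphic_on S" and S: "open S" "w \<in> S"
    and "deriv f w = 0" and ne: "deriv (deriv f) w \<noteq> 0"
  obtains N e g \<psi> where "N \<subseteq> S" "saddle_chart f w N e g \<psi>"
proof -
  obtain g0 r where r: "r > 0" and holg0: "g0 holomorphic_on ball w r"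
    and fact0: "\<And>z. z \<in> ball w r \<Longrightarrow> f z - f w = ((z - w) * g0 z) ^ 2"
    and g0: "\<And>z. z \<in> ball w r \<Longrightarrow> g0 z \<noteq> 0"
  proof (rule holomorphic_factor_order_of_zero_strong[OF holf S, of 2])
    show "(deriv ^^ 2) f w \<noteq> 0" using ne by (simp add: numeral_2_eq_2)
    show "(deriv ^^ i) f w = 0" if "0 < i" "i < 2" for i :: nat
    proof -
      have "i = 1" using that by simp
      then show ?thesis using assms(4) by simp
    qed
  qed auto
  \<comment> \<open>A square root of \<open>- \<i>\<close>: scaling by it compensates the factor
    \<open>\<i>\<close> that the chart puts before the square.\<close>
  define \<kappa> where "\<kappa> = csqrt (- \<i>)"
  have \<kappa>: "\<kappa>\<^sup>2 = - \<i>" "\<kappa> \<noteq> 0" by (auto simp: \<kappa>_def)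
  obtain r1 where r1: "r1 > 0" "ball w r1 \<subseteq> S" using S openE by metis
  define B where "B = ball w (min r r1)"
  define g where "g z = \<kappa> * g0 z" for z
  have B: "open B" "w \<in> B" "B \<subseteq> S" "B \<subseteq> ball w r"
    using r r1 by (auto simp: B_def)
  have holg: "g holomorphic_on B" unfolding g_def
    by (intro holomorphic_intros holomorphic_on_subset[OF holg0] B)
  have gne: "g z \<noteq> 0" if "z \<in> B" for z using that B(4) g0 \<kappa> by (auto simp: g_def)
  have fac: "f z = f w + \<i> * ((z - w) * g z)\<^sup>2" if "z \<in> B" for z
  proof -
    have "f z = f w + ((z - w) * g0 z) ^ 2" using fact0[of z] that B(4) by (auto simp: algebra_simps)
    also have "((z - w) * g0 z) ^ 2 = \<i> * (\<kappa>\<^sup>2 * ((z - w) * g0 z) ^ 2)"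
      by (simp add: \<kappa>)
    also have "\<dots> = \<i> * ((z - w) * g z)\<^sup>2" by (simp add: g_def power_mult_distrib)
    finally show ?thesis .
  qed
  define \<phi> where "\<phi> z = (z - w) * g z" for z
  have hol\<phi>: "\<phi> holomorphic_on B" unfolding \<phi>_def by (intro holomorphic_intros holg)
  have gder: "(g has_field_derivative deriv g z) (at z)" if "z \<in> B" for z
    using holg B(1) that holomorphic_derivI by blast
  have \<phi>der: "(\<phi> has_field_derivative (g z + (z - w) * deriv g z)) (at z)" if "z \<in> B" for z
    unfolding \<phi>_def by (auto intro!: derivative_eq_intros gder that simp: algebra_simps)
  have "deriv \<phi> w = g w" using DERIV_imp_deriv[OF \<phi>der[OF B(2)]] by simp
  then have "deriv \<phi> w \<noteq> 0" using gne B by auto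
  then obtain N e \<psi> where N: "open N" "w \<in> N" "N \<subseteq> B" "e > 0"
      "homeomorphism N (ball (\<phi> w) e) \<phi> \<psi>" "\<psi> holomorphic_on ball (\<phi> w) e"
    using holomorphic_local_chart[OF hol\<phi> B(1,2)] by metis
  \<comment> \<open>The cofactor in \<open>deriv f z = (z - w) * k z\<close>; the second derivative
    at \<open>w\<close> is then just \<open>k w\<close>, and \<open>g\<close> need not be
    differentiated twice.\<close>
  define k where "k z = \<i> * (2 * g z * (g z + (z - w) * deriv g z))" for z
  have "(f has_field_derivative (z - w) * k z) (at z)" if "z \<in> B" for z
  proof -
    have "((\<lambda>z. f w + \<i> * (\<phi> z)\<^sup>2) has_field_derivative (z - w) * k z) (at z)"
      by (auto intro!: derivative_eq_intros \<phi>der that simp: k_def) (simp add: \<phi>_def algebra_simps)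
    then show ?thesis
      by (rule DERIV_cong_ev[THEN iffD1, OF refl _ refl, rotated])
         (use fac B(1) that in \<open>auto simp: \<phi>_def eventually_nhds\<close>)
  qed
  then have dz: "deriv f z = (z - w) * k z" if "z \<in> B" for z using DERIV_imp_deriv that by blast
  have holk: "k holomorphic_on B" unfolding k_def
    by (intro holomorphic_intros holg holomorphic_deriv B(1))
  have kder: "(k has_field_derivative deriv k w) (at w)"
    using holk B(1,2) holomorphic_derivI by blast
  have "((\<lambda>z. (z - w) * k z) has_field_derivative k w) (at w)"
    by (auto intro!: derivative_eq_intros kder)
  then have "(deriv f has_field_derivative k w) (at w)"
    by (rule DERIV_cong_ev[THEN iffD1, OF refl _ refl, rotated])
       (use dz B in \<open>auto simp: eventually_nhds\<close>)
  then have dd: "deriv (deriv f) w = 2 * \<i> * (g w)\<^sup>2"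
    using DERIV_imp_deriv by (fastforce simp: k_def power2_eq_square)
  show ?thesis
  proof (rule that)
    show "N \<subseteq> S" using N(3) B(3) by auto
    show "saddle_chart f w N e g \<psi>" unfolding saddle_chart_def
    proof (intro conjI)
      show "g holomorphic_on N" using holg N(3) holomorphic_on_subset by blast
      show "homeomorphism N (ball 0 e) (\<lambda>z. (z - w) * g z) \<psi>"
        using N(5) by (simp add: \<phi>_def[abs_def])
      show "\<psi> holomorphic_on ball 0 e" using N(6) by (simp add: \<phi>_def)
    qed (use N gne fac dd in auto)
  qed
qed

section \<open>Proper holomorphic functions on the punctured plane\<close>

locale proper_on_punctured_plane =
  fixes H :: "complex \<Rightarrow> complex"
  assumes holo: "H holomorphic_on - {0}"
    and proper: "\<exists>r R. 0 < r \<and> (\<forall>z. z \<noteq> 0 \<longrightarrow> norm (H z) \<le> K \<longrightarrow> r \<le> norm z \<and> norm z \<le> R)"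
begin

lemma open_punctured: "open (- {0 :: complex})" by auto

lemma connected_punctured: "connected (- {0 :: complex})"
  by (simp add: connected_punctured_universe)

lemma continuous_H: "continuous_on (- {0}) H"
  using holo holomorphic_on_imp_continuous_on by blast

lemma isCont_H: "z \<noteq> 0 \<Longrightarrow> isCont H z"
  using continuous_H by (simp add: continuous_on_eq_continuous_at open_punctured)

lemma has_derivative_H: "z \<noteq> 0 \<Longrightarrow> (H has_field_derivative deriv H z) (at z)"
  using holo open_punctured holomorphic_derivI by blast

text \<open>A bound on \<open>H\<close> confines the sequence to a closed annulus, which is compact
  and omits the puncture.\<close>

lemma convergent_subsequence:
  assumes nz: "\<And>n :: nat. z n \<noteq> 0" and bd: "\<And>n. norm (H (z n)) \<le> K"
  obtains l s where "l \<noteq> 0" "strict_mono s" "(z \<circ> s) \<longlonglongrightarrow> l" "(\<lambda>n. H (z (s n))) \<longlonglongrightarrow> H l"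
proof -
  obtain r R where r: "0 < r" "\<And>z. z \<noteq> 0 \<Longrightarrow> norm (H z) \<le> K \<Longrightarrow> r \<le> norm z \<and> norm z \<le> R"
    using proper[of K] by blast
  have "compact (cball 0 R - ball (0::complex) r)" by (intro compact_diff) auto
  moreover have "\<And>n. z n \<in> cball 0 R - ball 0 r" using r(2)[OF nz bd] by (simp add: not_less)
  ultimately obtain l s where l: "l \<in> cball 0 R - ball 0 r" "strict_mono s" "(z \<circ> s) \<longlonglongrightarrow> l"
    unfolding compact_def by metis
  have "l \<noteq> 0" using l(1) r(1) by auto
  moreover have "(\<lambda>n. H ((z \<circ> s) n)) \<longlonglongrightarrow> H l"
    using isCont_tendsto_compose[OF isCont_H[OF \<open>l \<noteq> 0\<close>] l(3)] .
  ultimately show ?thesis using l that by auto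
qed

lemma not_constant: "\<not> H constant_on - {0}"
proof
  assume "H constant_on - {0}"
  then obtain k where k: "\<And>z. z \<noteq> 0 \<Longrightarrow> H z = k" unfolding constant_on_def by auto
  obtain r R where r: "0 < r" "\<And>z. z \<noteq> 0 \<Longrightarrow> norm (H z) \<le> norm k \<Longrightarrow> r \<le> norm z \<and> norm z \<le> R"
    using proper[of "norm k"] by blast
  have "of_real (r/2) \<noteq> (0::complex)" using r(1) by auto
  from r(2)[OF this] k[OF this] r(1) show False by auto
qed

lemma open_image: "open U \<Longrightarrow> U \<subseteq> - {0} \<Longrightarrow> open (H ` U)"
  using open_mapping_thm[OF holo open_punctured connected_punctured _ _ not_constant] by blast

lemma open_preimage: "open D \<Longrightarrow> open {z. z \<noteq> 0 \<and> H z \<in> D}"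
  using continuous_open_preimage[OF continuous_H open_punctured, of D]
  by (simp add: vimage_def Int_def)

text \<open>The image of a component \<open>W\<close> is open by the open mapping theorem. It is
  also closed in \<open>D\<close>: if values \<open>H (z n)\<close> converge inside
  \<open>D\<close>, properness makes the \<open>z n\<close> subconverge to some \<open>y\<close>
  over the limit, and the component of \<open>y\<close>, being open, meets \<open>W\<close> and so
  equals \<open>W\<close>. Connectedness of \<open>D\<close> does the rest.\<close>

lemma component_onto:
  assumes D: "open D" "connected D" and u: "u \<noteq> 0" "H u \<in> D"
  shows "H ` connected_component_set {z. z \<noteq> 0 \<and> H z \<in> D} u = D"
proof -
  define O' where "O' = {z. z \<noteq> 0 \<and> H z \<in> D}"
  define W where "W = connected_component_set O' u"
  have "open O'" unfolding O'_def by (rule open_preimage[OF D(1)])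
  then have oW: "open W" unfolding W_def by (rule open_connected_component)
  have WO: "W \<subseteq> O'" unfolding W_def by (rule connected_component_subset)
  have uW: "u \<in> W" using u by (simp add: W_def O'_def)
  have op: "openin (top_of_set D) (H ` W)"
  proof -
    have "open (H ` W)" using open_image[OF oW] WO O'_def by auto
    moreover have "H ` W \<subseteq> D" using WO O'_def by auto
    ultimately show ?thesis by (simp add: D(1) openin_open_eq)
  qed
  have lim: "l \<in> H ` W" if lD: "l \<in> D" and lcl: "l \<in> closure (H ` W)" for l
  proof -
    obtain x where as: "(\<forall>n. x n \<in> H ` W) \<and> x \<longlonglongrightarrow> l"
      using lcl unfolding closure_sequential by metis
    then have "\<forall>n. \<exists>z\<in>W. x n = H z" by auto
    then obtain z where z: "\<And>n. z n \<in> W" "\<And>n. x n = H (z n)" by metis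
    from as have "Bseq x" using convergent_imp_Bseq convergent_def by blast
    then obtain K where "\<And>n. norm (x n) \<le> K" unfolding Bseq_def by auto
    then have "\<And>n. norm (H (z n)) \<le> K" using z(2) by simp
    moreover have "\<And>n. z n \<noteq> 0" using z(1) WO O'_def by auto
    ultimately obtain y s where y: "y \<noteq> 0" "strict_mono s" "(z \<circ> s) \<longlonglongrightarrow> y"
        "(\<lambda>n. H (z (s n))) \<longlonglongrightarrow> H y"
      using convergent_subsequence by metis
    have "(x \<circ> s) \<longlonglongrightarrow> l" using as LIMSEQ_subseq_LIMSEQ y(2) by blast
    then have Hy: "H y = l" using y(4) LIMSEQ_unique z(2) by (auto simp: o_def)
    have yO: "y \<in> O'" using lD Hy y(1) O'_def by auto
    define Y where "Y = connected_component_set O' y"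
    have "open Y" "y \<in> Y" unfolding Y_def
      using \<open>open O'\<close> yO open_connected_component by auto
    then have "eventually (\<lambda>n. (z \<circ> s) n \<in> Y) sequentially"
      using y(3) topological_tendstoD by blast
    then obtain n where "z (s n) \<in> Y" by (auto simp: eventually_sequentially)
    then have "Y = W" using z(1)[of "s n"] unfolding Y_def W_def
      by (metis connected_component_eq)
    then show "l \<in> H ` W" using \<open>y \<in> Y\<close> Hy by auto
  qed
  have "H ` W \<subseteq> D" using WO O'_def by auto
  then have "H ` W = D \<inter> closure (H ` W)"
    using lim closure_subset[of "H ` W"] by blast
  then have cl: "closedin (top_of_set D) (H ` W)"
    using closedin_closed_Int[OF closed_closure] by metis
  have "H ` W = {} \<or> H ` W = D"
    using D(2) op cl unfolding connected_clopen by blast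
  then show ?thesis using uW unfolding W_def O'_def by blast
qed

end

subsection \<open>Superlevel sets and the mountain pass\<close>

context proper_on_punctured_plane
begin

definition superlevel :: "real \<Rightarrow> complex set" where
  "superlevel h = {z. z \<noteq> 0 \<and> h < Im (H z)}"

definition circle_max :: real where
  "circle_max = (SUP z\<in>sphere 0 1. norm (H z))"

(* Above the level circle_max the superlevel set does not meet the unit circle, so there "inside the unit circle"
   and "outside the unit circle" distinguish the hills at 0 from those at infinity. *)
definition hill :: "(complex \<Rightarrow> bool) \<Rightarrow> real \<Rightarrow> complex set" where
  "hill P h = {u. \<exists>v. P v \<and> circle_max < Im (H v) \<and> connected_component (superlevel h) u v}"

abbreviation "inner_hill \<equiv> hill (\<lambda>v. norm v < 1)"
abbreviation "outer_hill \<equiv> hill (\<lambda>v. 1 < norm v)"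

lemma norm_le_circle_max:
  assumes "norm z = 1"
  shows "norm (H z) \<le> circle_max"
  unfolding circle_max_def
proof (rule cSUP_upper)
  have "continuous_on (sphere 0 1) (\<lambda>z. norm (H z))"
    by (intro continuous_on_norm continuous_on_subset[OF continuous_H]) auto
  then show "bdd_above ((\<lambda>z. norm (H z)) ` sphere 0 1)"
    by (intro bounded_imp_bdd_above compact_imp_bounded compact_continuous_image) auto
qed (use assms in auto)

lemma norm_ne_1: "circle_max < norm (H z) \<Longrightarrow> norm z \<noteq> 1"
  using norm_le_circle_max by force

lemma norm_less_1_iff_of_connected:
  assumes "connected C" "\<And>z. z \<in> C \<Longrightarrow> circle_max < norm (H z)" "u \<in> C" "v \<in> C"
  shows "norm u < 1 \<longleftrightarrow> norm v < 1"
proof -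
  have "connected (norm ` C)" by (intro connected_continuous_image assms(1) continuous_intros)
  moreover have "1 \<notin> norm ` C" using assms(2) norm_ne_1 by force
  ultimately show ?thesis
    using connectedD_interval[of "norm ` C" "norm u" "norm v" 1]
      connectedD_interval[of "norm ` C" "norm v" "norm u" 1] assms(3,4)
    by (metis imageI linorder_not_less nle_le)
qed

lemma open_superlevel: "open (superlevel h)"
  using open_preimage[OF open_halfspace_Im_gt[of h]] by (simp add: superlevel_def)

lemma superlevel_mono: "h' \<le> h \<Longrightarrow> superlevel h \<subseteq> superlevel h'"
  by (auto simp: superlevel_def)

lemma hill_connected_component:
  "u \<in> hill P h \<Longrightarrow> connected_component (superlevel h) u v \<Longrightarrow> v \<in> hill P h"
  unfolding hill_def by (auto intro: connected_component_trans connected_component_sym)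

lemma hill_connected:
  assumes "u \<in> hill P h" "connected C" "C \<subseteq> superlevel h" "u \<in> C"
  shows "C \<subseteq> hill P h"
  using assms hill_connected_component connected_component_def by blast

lemma hill_subset: "hill P h \<subseteq> superlevel h"
  unfolding hill_def using connected_component_in by fastforce

lemma hill_mono: "h' \<le> h \<Longrightarrow> hill P h \<subseteq> hill P h'"
  unfolding hill_def using connected_component_mono[OF superlevel_mono] by blast

lemma open_hill: "open (hill P h)"
proof (subst open_subopen, intro ballI)
  fix u assume u: "u \<in> hill P h"
  let ?W = "connected_component_set (superlevel h) u"
  have "open ?W" by (intro open_connected_component open_superlevel)
  moreover have "u \<in> ?W" using u hill_subset by auto
  moreover have "?W \<subseteq> hill P h" using hill_connected_component[OF u] by auto
  ultimately show "\<exists>T. open T \<and> u \<in> T \<and> T \<subseteq> hill P h" by blast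
qed

text \<open>A component is mapped onto the half plane above \<open>h\<close>, so it has a point
  higher than \<open>circle_max\<close>; such a point is off the unit circle and puts the component
  into one of the two hills.\<close>

lemma superlevel_eq_hills: "superlevel h = inner_hill h \<union> outer_hill h"
proof -
  have "u \<in> inner_hill h \<union> outer_hill h" if u: "u \<in> superlevel h" for u
  proof -
    have u': "u \<noteq> 0" "H u \<in> {w. h < Im w}" using u by (auto simp: superlevel_def)
    have "H ` connected_component_set (superlevel h) u = {w. h < Im w}"
      using component_onto[OF open_halfspace_Im_gt _ u'] convex_connected[OF convex_halfspace_Im_gt]
      by (simp add: superlevel_def)
    moreover have "\<i> * of_real (max h circle_max + 1) \<in> {w. h < Im w}" by auto
    ultimately have "\<i> * of_real (max h circle_max + 1) \<in> H ` connected_component_set (superlevel h) u"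
      by simp
    then obtain v where v: "connected_component (superlevel h) u v"
        "H v = \<i> * of_real (max h circle_max + 1)"
      by (auto simp del: of_real_add)
    have "circle_max < Im (H v)" by (simp add: v(2))
    moreover from this have "norm v \<noteq> 1"
      using norm_ne_1 abs_Im_le_cmod[of "H v"] by fastforce
    ultimately show ?thesis using v(1) unfolding hill_def by (auto simp: neq_iff)
  qed
  then show ?thesis using hill_subset by blast
qed

text \<open>Where the imaginary part is still low, a large real part serves as well. The component
  of \<open>u\<close> over the quarter plane \<open>D\<close> stays off the unit circle because the
  real part alone exceeds \<open>circle_max\<close> in absolute value; it is mapped onto
  \<open>D\<close>, hence climbs above \<open>circle_max\<close> without changing sides.\<close>

lemma steep_in_hill:
  assumes u: "u \<in> superlevel h" "P u" and P: "P = (\<lambda>v. norm v < 1) \<or> P = (\<lambda>v. 1 < norm v)"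
    and steep: "circle_max < \<bar>Re (H u)\<bar> \<or> circle_max < Im (H u)"
  shows "u \<in> hill P h"
  using steep
proof
  assume "circle_max < Im (H u)"
  then show ?thesis using u by (auto simp: hill_def intro!: exI[of _ u])
next
  assume st: "circle_max < \<bar>Re (H u)\<bar>"
  define s :: real where "s = (if Re (H u) \<ge> 0 then 1 else -1)"
  have s: "s * Re (H u) = \<bar>Re (H u)\<bar>" "s = 1 \<or> s = -1" by (auto simp: s_def)
  define D where "D = {w. circle_max < s * Re w} \<inter> {w. h < Im w}"
  have D: "open D" "connected D"
  proof -
    have "D = (if s = 1 then {w. Re w > circle_max} else {w. Re w < - circle_max}) \<inter> {w. h < Im w}"
      using s(2) by (auto simp: D_def)
    moreover have "convex \<dots>" "open \<dots>"
      by (auto intro!: convex_Int convex_halfspace_Im_gt convex_halfspace_Re_gt convex_halfspace_Re_lt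
          open_Int open_halfspace_Im_gt open_halfspace_Re_gt open_halfspace_Re_lt)
    ultimately show "open D" "connected D" using convex_connected by metis+
  qed
  have u': "u \<noteq> 0" "H u \<in> D" using u st s(1) by (auto simp: superlevel_def D_def)
  define W where "W = connected_component_set {z. z \<noteq> 0 \<and> H z \<in> D} u"
  have W: "connected W" "u \<in> W" "\<And>z. z \<in> W \<Longrightarrow> z \<noteq> 0 \<and> H z \<in> D"
    using u' connected_component_subset[of "{z. z \<noteq> 0 \<and> H z \<in> D}" u] by (auto simp: W_def)
  \<comment> \<open>Moving straight up keeps the real part, so the target remains in
    \<open>D\<close>.\<close>
  have "Complex (Re (H u)) (max h circle_max + 1) \<in> D"
    using u' by (auto simp: D_def)
  then have "Complex (Re (H u)) (max h circle_max + 1) \<in> H ` W"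
    using component_onto[OF D u'] by (simp add: W_def)
  then obtain v where v: "v \<in> W" "H v = Complex (Re (H u)) (max h circle_max + 1)"
    by (elim imageE) simp
  have big: "circle_max < norm (H z)" if "z \<in> W" for z
    using W(3)[OF that] s(2) abs_Re_le_cmod[of "H z"] by (auto simp: D_def)
  have "norm u < 1 \<longleftrightarrow> norm v < 1"
    using norm_less_1_iff_of_connected[OF W(1) big W(2) v(1)] .
  moreover have "norm u \<noteq> 1" "norm v \<noteq> 1" using big W(2) v(1) norm_ne_1 by auto
  ultimately have "P v" using P \<open>P u\<close> by auto
  moreover have "W \<subseteq> superlevel h" using W(3) by (auto simp: D_def superlevel_def)
  then have "connected_component (superlevel h) u v"
    unfolding connected_component_def using W v(1) by blast
  ultimately show ?thesis using v(2) by (auto simp: hill_def)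
qed

lemma hills_near_ends:
  obtains r R where "0 < r" "r < R"
    "\<And>u. u \<in> superlevel h \<Longrightarrow> norm u < r \<Longrightarrow> u \<in> inner_hill h"
    "\<And>u. u \<in> superlevel h \<Longrightarrow> R < norm u \<Longrightarrow> u \<in> outer_hill h"
proof -
  \<comment> \<open>Beyond this bound the real or the imaginary part exceeds
    \<open>\<bar>h\<bar> + \<bar>circle_max\<bar>\<close> in absolute value. On the superlevel set a
    large negative imaginary part is excluded, so \<open>steep_in_hill\<close> applies.\<close>
  obtain r R where r: "0 < r"
    "\<And>z. z \<noteq> 0 \<Longrightarrow> norm (H z) \<le> 2 * (\<bar>h\<bar> + \<bar>circle_max\<bar>) \<Longrightarrow> r \<le> norm z \<and> norm z \<le> R"
    using proper by blast
  have steep: "circle_max < \<bar>Re (H u)\<bar> \<or> circle_max < Im (H u)"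
    if "u \<in> superlevel h" "norm u < r \<or> norm u > R" for u
  proof -
    have "u \<noteq> 0" using that(1) by (simp add: superlevel_def)
    then have "norm (H u) > 2 * (\<bar>h\<bar> + \<bar>circle_max\<bar>)"
      using r(2)[of u] that(2) by (intro not_le_imp_less) auto
    moreover have "h < Im (H u)" using that by (simp add: superlevel_def)
    ultimately show ?thesis using cmod_le[of "H u"] by argo
  qed
  show ?thesis
  proof (rule that[of "min r 1" "max R 1 + 1"])
    show "u \<in> inner_hill h" if u: "u \<in> superlevel h" "norm u < min r 1" for u
      using u steep[of u] by (intro steep_in_hill) auto
    show "u \<in> outer_hill h" if u: "u \<in> superlevel h" "max R 1 + 1 < norm u" for u
    proof -
      have "R < norm u" "1 < norm u" using u(2) by linarith+
      then show ?thesis using u(1) steep[of u] by (intro steep_in_hill) auto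
    qed
  qed (use r in auto)
qed

lemma hills_disjoint_of_high:
  assumes "circle_max \<le> h"
  shows "inner_hill h \<inter> outer_hill h = {}"
proof (rule ccontr)
  assume "\<not> ?thesis"
  then obtain u where "u \<in> inner_hill h" "u \<in> outer_hill h" by auto
  then obtain v1 v2 where v: "norm v1 < 1" "norm v2 > 1"
     "connected_component (superlevel h) u v1" "connected_component (superlevel h) u v2"
    by (auto simp: hill_def)
  then have "connected_component (superlevel h) v1 v2"
    by (meson connected_component_sym connected_component_trans)
  then obtain C where C: "connected C" "C \<subseteq> superlevel h" "v1 \<in> C" "v2 \<in> C"
    by (auto simp: connected_component_def)
  have "circle_max < norm (H z)" if "z \<in> C" for z
    using C(2) that assms abs_Im_le_cmod[of "H z"] by (force simp: superlevel_def)
  from norm_less_1_iff_of_connected[OF C(1) this C(3,4)] v show False by auto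
qed

text \<open>A path that joins the two sides is compact, so its lowest point lies strictly above
  \<open>h\<close>, and half of that margin can be given away. Hence the supremum of the heights at
  which the hills meet is not attained.\<close>

lemma hills_meet_higher:
  assumes "inner_hill h \<inter> outer_hill h \<noteq> {}"
  obtains h' where "h < h'" "inner_hill h' \<inter> outer_hill h' \<noteq> {}"
proof -
  obtain u where "u \<in> inner_hill h" "u \<in> outer_hill h" using assms by auto
  then obtain v1 v2 where v: "norm v1 < 1" "norm v2 > 1" "circle_max < Im (H v1)" "circle_max < Im (H v2)"
     "connected_component (superlevel h) u v1" "connected_component (superlevel h) u v2"
    by (auto simp: hill_def)
  then have "connected_component (superlevel h) v1 v2"
    by (meson connected_component_sym connected_component_trans)
  then have "path_component (superlevel h) v1 v2"
    using open_path_connected_component[OF open_superlevel] by metis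
  then obtain p where p: "path p" "path_image p \<subseteq> superlevel h" "pathstart p = v1" "pathfinish p = v2"
    by (auto simp: path_component_def)
  have "compact (path_image p)" "path_image p \<noteq> {}" by (auto simp: p compact_path_image)
  moreover have "continuous_on (path_image p) (\<lambda>z. Im (H z))"
    by (intro continuous_intros continuous_on_subset[OF continuous_H]) (use p(2) in \<open>auto simp: superlevel_def\<close>)
  ultimately obtain z0 where z0: "z0 \<in> path_image p" "\<And>z. z \<in> path_image p \<Longrightarrow> Im (H z0) \<le> Im (H z)"
    using continuous_attains_inf[of "path_image p" "\<lambda>z. Im (H z)"] by auto
  define h' where "h' = (h + Im (H z0)) / 2"
  have h0: "h < Im (H z0)" using z0(1) p(2) by (auto simp: superlevel_def)
  then have hh: "h < h'" "h' < Im (H z0)" by (auto simp: h'_def)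
  have "path_image p \<subseteq> superlevel h'"
  proof
    fix z assume "z \<in> path_image p"
    then show "z \<in> superlevel h'" using p(2) z0(2)[of z] hh by (auto simp: superlevel_def)
  qed
  then have "connected_component (superlevel h') v1 v2" 
    unfolding connected_component_def
    using connected_path_image[OF p(1)] p(3,4) pathstart_in_path_image[of p] pathfinish_in_path_image[of p] by blast
  moreover from this have "connected_component (superlevel h') v1 v1"
    using connected_component_in by fastforce
  ultimately have "v1 \<in> inner_hill h' \<inter> outer_hill h'"
    using v by (auto simp: hill_def)
  then show ?thesis using that hh(1) by blast
qed

text \<open>\<open>H\<close> is open, so there are slightly higher points arbitrarily close to
  \<open>x\<close>. Read contrapositively, a nonzero point outside both closures lies strictly below
  \<open>h\<close>; this is how the connecting path is kept low.\<close>

lemma level_in_closure_hills: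
  assumes "x \<noteq> 0" "Im (H x) \<ge> h"
  shows "x \<in> closure (inner_hill h) \<union> closure (outer_hill h)"
proof -
  have "x \<in> closure (superlevel h)"
    unfolding closure_approachable
  proof (intro allI impI)
    fix e :: real assume e: "0 < e"
    define U where "U = ball x e - {0}"
    have "open U" "x \<in> U" using e assms(1) by (auto simp: U_def)
    then have "open (H ` U)" using open_image[of U] by (auto simp: U_def)
    moreover have "H x \<in> H ` U" using \<open>x \<in> U\<close> by auto
    ultimately obtain d where d: "d > 0" "ball (H x) d \<subseteq> H ` U" using openE by metis
    have "H x + \<i> * of_real (d/2) \<in> ball (H x) d"
      using d(1) by (auto simp: dist_norm norm_mult)
    then obtain y where y: "y \<in> U" "H y = H x + \<i> * of_real (d/2)" using d(2) by (metis imageE subsetD)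
    then show "\<exists>y\<in>superlevel h. dist y x < e"
      using assms(2) d(1) by (intro bexI[of _ y]) (auto simp: U_def superlevel_def dist_commute)
  qed
  then show ?thesis using superlevel_eq_hills by (simp add: closure_Un)
qed

text \<open>At the supremum \<open>hs\<close> of the heights at which the hills meet, they are
  already disjoint. If their closures were disjoint as well, disjoint open sets would separate them,
  while the connected sets that join inside to outside just below \<open>hs\<close> would have to
  leave these open sets at points whose heights tend to \<open>hs\<close>. An accumulation point of
  such exits has height at least \<open>hs\<close>, hence lies in one of the closures: a
  contradiction.\<close>

lemma mountain_pass:
  assumes "inner_hill h \<inter> outer_hill h \<noteq> {}"
  obtains h' w where "h < h'" "inner_hill h' \<inter> outer_hill h' = {}"
    "w \<noteq> 0" "w \<in> closure (inner_hill h')" "w \<in> closure (outer_hill h')"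
proof -
  define J where "J = {h. inner_hill h \<inter> outer_hill h \<noteq> {}}"
  have bdd: "bdd_above J"
  proof (rule bdd_aboveI)
    show "x \<le> circle_max" if "x \<in> J" for x
      using hills_disjoint_of_high[of x] that by (cases "circle_max \<le> x") (auto simp: J_def)
  qed
  have "J \<noteq> {}" using assms by (auto simp: J_def)
  define hs where "hs = Sup J"
  have up: "x \<le> hs" if "x \<in> J" for x unfolding hs_def by (rule cSup_upper[OF that bdd])
  have hsJ: "hs \<notin> J"
  proof
    assume "hs \<in> J"
    then obtain h' where "hs < h'" "h' \<in> J"
      using hills_meet_higher[of hs] unfolding J_def by auto
    with up[of h'] show False by auto
  qed
  have disj: "inner_hill hs \<inter> outer_hill hs = {}" using hsJ by (auto simp: J_def)
  have "h \<in> J" using assms by (auto simp: J_def)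
  then have "h < hs" using up[of h] hsJ by (cases "h = hs") auto
  have lower: "h' \<in> J" if h': "h' < hs" for h'
  proof -
    obtain j where "j \<in> J" "h' < j" using less_cSupD[OF \<open>J \<noteq> {}\<close>] h' hs_def by metis
    then show ?thesis using hill_mono[of h' j] unfolding J_def by fastforce
  qed
  obtain r R where rR: "0 < r" "r < R"
    "\<And>u. u \<in> superlevel hs \<Longrightarrow> norm u < r \<Longrightarrow> u \<in> inner_hill hs"
    "\<And>u. u \<in> superlevel hs \<Longrightarrow> R < norm u \<Longrightarrow> u \<in> outer_hill hs"
    using hills_near_ends by metis
  \<comment> \<open>A disc around 0 and a neighbourhood of infinity are added so that points outside
    both sets stay in a compact annulus. Near each end the superlevel set belongs to the matching
    hill, so neither addition meets the closure of the other hill.\<close>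
  define S where "S = closure (inner_hill hs) \<union> cball 0 (r/2)"
  define T where "T = closure (outer_hill hs) \<union> {z. R + 1 \<le> norm z}"
  have inR: "closure (inner_hill hs) \<subseteq> cball 0 R"
  proof (rule closure_minimal)
    show "inner_hill hs \<subseteq> cball 0 R"
    proof
      fix u assume u: "u \<in> inner_hill hs"
      then have "u \<in> superlevel hs" "u \<notin> outer_hill hs" using hill_subset disj by auto
      then show "u \<in> cball 0 R" using rR(4)[of u] by (auto simp: not_less[symmetric])
    qed
  qed auto
  have outr: "closure (outer_hill hs) \<subseteq> {z. r \<le> norm z}"
  proof (rule closure_minimal)
    show "outer_hill hs \<subseteq> {z. r \<le> norm z}"
    proof
      fix u assume u: "u \<in> outer_hill hs"
      then have "u \<in> superlevel hs" "u \<notin> inner_hill hs" using hill_subset disj by auto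
      then show "u \<in> {z. r \<le> norm z}" using rR(3)[of u] by (auto simp: not_less[symmetric])
    qed
    show "closed {z :: complex. r \<le> norm z}" by (intro closed_Collect_le continuous_intros)
  qed
  show ?thesis
  proof (cases "S \<inter> T = {}")
    case False
    then obtain w where w: "w \<in> S" "w \<in> T" by auto
    have "w \<notin> cball 0 (r/2)" "w \<notin> {z. R + 1 \<le> norm z}"
      using w rR(1,2) inR outr by (auto simp: S_def T_def subset_iff)
    moreover from this have "w \<noteq> 0" using rR by auto
    ultimately show ?thesis using w that[OF \<open>h < hs\<close> disj] by (auto simp: S_def T_def)
  next
    case True
    have "closed S" "closed T" 
      by (auto simp: S_def T_def intro!: closed_Un closed_Collect_le continuous_intros)
    then obtain OA OB where O': "open OA" "open OB" "S \<subseteq> OA" "T \<subseteq> OB" "OA \<inter> OB = {}"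
      using separation_normal True by metis
    have "\<exists>x. x \<noteq> 0 \<and> x \<notin> OA \<union> OB \<and> hs - 1 / real (Suc n) < Im (H x) \<and> Im (H x) \<le> hs" for n
    proof -
      let ?h = "hs - 1 / real (Suc n)"
      have "?h \<in> J" by (intro lower) auto
      then obtain u where "u \<in> inner_hill ?h" "u \<in> outer_hill ?h" by (auto simp: J_def)
      then obtain v1 v2 where v: "norm v1 < 1" "norm v2 > 1" "circle_max < Im (H v1)" "circle_max < Im (H v2)"
        "connected_component (superlevel ?h) u v1" "connected_component (superlevel ?h) u v2"
        by (auto simp: hill_def)
      then have "connected_component (superlevel ?h) v1 v2"
        by (meson connected_component_sym connected_component_trans)
      then obtain C where C: "connected C" "C \<subseteq> superlevel ?h" "v1 \<in> C" "v2 \<in> C"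
        by (auto simp: connected_component_def)
      \<comment> \<open>The hills are disjoint at height \<open>circle_max\<close>, so
        \<open>hs\<close> cannot exceed it. Thus \<open>v1\<close> and \<open>v2\<close>, which are
        higher than \<open>circle_max\<close>, are above \<open>hs\<close> too.\<close>
      have "hs \<le> circle_max"
        using lower[of circle_max] hills_disjoint_of_high[of circle_max] by (force simp: J_def)
      then have "v1 \<in> superlevel hs" "v2 \<in> superlevel hs"
        using v C by (auto simp: superlevel_def)
      then have "v1 \<in> inner_hill hs" "v2 \<in> outer_hill hs"
        using v by (auto intro!: steep_in_hill)
      then have "v1 \<in> OA" "v2 \<in> OB"
        using O'(3,4) closure_subset[of "inner_hill hs"] closure_subset[of "outer_hill hs"]
        unfolding S_def T_def by blast+
      then have "\<not> C \<subseteq> OA \<union> OB"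
        using connectedD[OF C(1) O'(1,2)] O'(5) C(3,4) by blast
      then obtain x where x: "x \<in> C" "x \<notin> OA \<union> OB" by auto
      have "x \<notin> inner_hill hs \<union> outer_hill hs"
        using x(2) O'(3,4) closure_subset[of "inner_hill hs"] closure_subset[of "outer_hill hs"]
        unfolding S_def T_def by blast
      then have "x \<notin> superlevel hs" using superlevel_eq_hills by auto
      then show ?thesis using x C(2) by (intro exI[of _ x]) (auto simp: superlevel_def)
    qed
    then obtain x where x: "\<And>n. x n \<noteq> 0" "\<And>n. x n \<notin> OA \<union> OB"
       "\<And>n. hs - 1 / real (Suc n) < Im (H (x n))" "\<And>n. Im (H (x n)) \<le> hs"
      by metis
    have "x n \<in> cball 0 (R + 1) - ball 0 (r/2)" for n
    proof -
      have "x n \<notin> S" "x n \<notin> T" using x(2)[of n] O' by auto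
      then show ?thesis by (auto simp: S_def T_def)
    qed
    moreover have "compact (cball 0 (R + 1) - ball (0::complex) (r/2))" by (intro compact_diff) auto
    ultimately obtain l s where l: "l \<in> cball 0 (R + 1) - ball 0 (r/2)" "strict_mono s" "(x \<circ> s) \<longlonglongrightarrow> l"
      unfolding compact_def by metis
    have "l \<noteq> 0" using l(1) rR(1) by auto
    have "(\<lambda>n. Im (H ((x \<circ> s) n))) \<longlonglongrightarrow> Im (H l)"
      by (intro tendsto_Im isCont_tendsto_compose[OF isCont_H[OF \<open>l \<noteq> 0\<close>] l(3)])
    moreover have "(\<lambda>n. hs - 1 / real (Suc (s n))) \<longlonglongrightarrow> hs"
    proof -
      have "(\<lambda>n. hs - 1 / real (Suc n)) \<longlonglongrightarrow> hs - 0"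
        by (intro tendsto_intros LIMSEQ_Suc lim_inverse_n')
      from LIMSEQ_subseq_LIMSEQ[OF this l(2)] show ?thesis by (simp add: o_def)
    qed
    ultimately have "hs \<le> Im (H l)"
      using x(3) by (intro LIMSEQ_le) (auto intro: less_imp_le)
    then have "l \<in> S \<union> T" using level_in_closure_hills[OF \<open>l \<noteq> 0\<close>] by (auto simp: S_def T_def)
    moreover have "l \<in> - (OA \<union> OB)"
    proof (rule closed_sequentially[of "- (OA \<union> OB)" "x \<circ> s"])
      show "closed (- (OA \<union> OB))" using O' by auto
    qed (use x(2) l(3) in auto)
    ultimately show ?thesis using O' by auto
  qed
qed

end

subsection \<open>Lifting vertical rays\<close>

context proper_on_punctured_plane
begin

lemma regular_chart:
  assumes "l \<noteq> 0" "deriv H l \<noteq> 0"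
  obtains N e \<psi> where "open N" "l \<in> N" "N \<subseteq> - {0}" "e > 0"
    "homeomorphism N (ball (H l) e) H \<psi>" "continuous_on (ball (H l) e) \<psi>"
    "\<And>y. y \<in> ball (H l) e \<Longrightarrow> deriv H (\<psi> y) \<noteq> 0 \<and>
       (\<psi> has_field_derivative inverse (deriv H (\<psi> y))) (at y)"
proof -
  obtain N e \<psi> where N: "open N" "l \<in> N" "N \<subseteq> - {0}" "e > 0"
    "homeomorphism N (ball (H l) e) H \<psi>" "\<psi> holomorphic_on ball (H l) e"
    using holomorphic_local_chart[OF holo open_punctured _ assms(2)] assms(1) by auto
  have "deriv H (\<psi> y) \<noteq> 0 \<and> (\<psi> has_field_derivative inverse (deriv H (\<psi> y))) (at y)"
    if y: "y \<in> ball (H l) e" for y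
  proof -
    have "\<psi> y \<in> N" using N(5) y by (auto simp: homeomorphism_def)
    then have "\<psi> y \<noteq> 0" using N(3) by auto
    have d: "(\<psi> has_field_derivative deriv \<psi> y) (at y)"
      using N(6) y holomorphic_derivI open_ball by blast
    have "((H \<circ> \<psi>) has_field_derivative deriv H (\<psi> y) * deriv \<psi> y) (at y)"
      by (rule DERIV_chain[OF has_derivative_H[OF \<open>\<psi> y \<noteq> 0\<close>] d])
    moreover have "eventually (\<lambda>x. (H \<circ> \<psi>) x = x) (nhds y)"
      unfolding eventually_nhds using N(5) y
      by (intro exI[of _ "ball (H l) e"]) (auto simp: homeomorphism_def)
    ultimately have "((\<lambda>x. x) has_field_derivative deriv H (\<psi> y) * deriv \<psi> y) (at y)"
      by (subst (asm) DERIV_cong_ev[OF refl _ refl]) simp_all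
    then have "deriv H (\<psi> y) * deriv \<psi> y = 1"
      using DERIV_unique DERIV_ident by blast
    then show ?thesis using d inverse_unique[of "deriv H (\<psi> y)" "deriv \<psi> y"] by auto
  qed
  then show ?thesis
    using that N holomorphic_on_imp_continuous_on by blast
qed

text \<open>The set of times of agreement is closed by continuity, and open because \<open>H\<close>
  is injective on a chart around a regular point.\<close>

lemma lift_unique:
  fixes I :: "real set"
  assumes "connected I" and z1: "continuous_on I z1" and z2: "continuous_on I z2"
    and reg: "\<And>\<tau>. \<tau> \<in> I \<Longrightarrow> z1 \<tau> \<noteq> 0 \<and> deriv H (z1 \<tau>) \<noteq> 0 \<and> H (z1 \<tau>) = H (z2 \<tau>)"
    and "\<tau>0 \<in> I" "z1 \<tau>0 = z2 \<tau>0" "\<tau> \<in> I"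
  shows "z1 \<tau> = z2 \<tau>"
proof -
  define E where "E = {\<tau> \<in> I. z1 \<tau> = z2 \<tau>}"
  have "E = {\<tau> \<in> I. z1 \<tau> - z2 \<tau> = 0}" by (auto simp: E_def)
  then have cl: "closedin (top_of_set I) E"
    using continuous_closedin_preimage_constant[of I "\<lambda>\<tau>. z1 \<tau> - z2 \<tau>" 0]
    by (simp add: z1 z2 continuous_on_diff)
  have op: "openin (top_of_set I) E"
  proof (subst openin_subopen, intro ballI)
    fix s assume s: "s \<in> E"
    then have "s \<in> I" "z1 s = z2 s" by (auto simp: E_def)
    obtain N e \<psi> where N: "open N" "z1 s \<in> N" "homeomorphism N (ball (H (z1 s)) e) H \<psi>"
      using regular_chart[of "z1 s"] reg[OF \<open>s \<in> I\<close>] by metis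
    define T where "T = (I \<inter> z1 -` N) \<inter> (I \<inter> z2 -` N)"
    have "openin (top_of_set I) T"
      unfolding T_def by (intro openin_Int continuous_openin_preimage_gen z1 z2 N)
    moreover have "s \<in> T" using N \<open>s \<in> I\<close> \<open>z1 s = z2 s\<close> by (auto simp: T_def)
    moreover have "T \<subseteq> E"
    proof
      fix x assume x: "x \<in> T"
      then have "\<psi> (H (z1 x)) = z1 x" "\<psi> (H (z2 x)) = z2 x"
        using N(3) by (auto simp: T_def homeomorphism_def)
      moreover have "x \<in> I" using x by (auto simp: T_def)
      ultimately have "z1 x = z2 x" using reg[of x] by metis
      then show "x \<in> E" using \<open>x \<in> I\<close> by (simp add: E_def)
    qed
    ultimately show "\<exists>T. openin (top_of_set I) T \<and> s \<in> T \<and> T \<subseteq> E" by blast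
  qed
  have "E = {} \<or> E = I" using assms(1) op cl unfolding connected_clopen by blast
  moreover have "\<tau>0 \<in> E" using assms by (auto simp: E_def)
  ultimately show ?thesis using assms(7) by (auto simp: E_def)
qed

text \<open>With \<open>a = deriv H z\<close> the differential is \<open>Im (a * h)\<close>, the
  Euclidean inner product of \<open>h\<close> with \<open>\<i> * cnj a\<close>.\<close>

lemma GDERIV_Im_H:
  assumes "z \<noteq> 0"
  shows "GDERIV (\<lambda>w. Im (H w)) z :> \<i> * cnj (deriv H z)"
proof -
  have "(H has_derivative (*) (deriv H z)) (at z)"
    using has_derivative_H[OF assms] by (simp add: has_field_derivative_def)
  then have "((\<lambda>w. Im (H w)) has_derivative (\<lambda>h. Im (deriv H z * h))) (at z)"
    by (rule has_derivative_Im)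
  moreover have "(\<lambda>h. Im (deriv H z * h)) = (\<lambda>h. inner h (\<i> * cnj (deriv H z)))"
    by (auto simp: inner_complex_def fun_eq_iff)
  ultimately show ?thesis by (simp add: gderiv_def)
qed

lemma lift_has_vector_derivative:
  assumes "open I" "continuous_on I z" "\<And>s. s \<in> I \<Longrightarrow> z s \<noteq> 0 \<and> H (z s) = c + \<i> * of_real s"
    and "\<tau> \<in> I" "deriv H (z \<tau>) \<noteq> 0"
  shows "(z has_vector_derivative \<i> / deriv H (z \<tau>)) (at \<tau>)"
proof -
  have z0: "z \<tau> \<noteq> 0" "H (z \<tau>) = c + \<i> * of_real \<tau>" using assms by auto
  obtain N e \<psi> where N: "open N" "z \<tau> \<in> N" "N \<subseteq> - {0}" "e > 0"
    "homeomorphism N (ball (H (z \<tau>)) e) H \<psi>"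
    "\<And>y. y \<in> ball (H (z \<tau>)) e \<Longrightarrow> deriv H (\<psi> y) \<noteq> 0 \<and>
       (\<psi> has_field_derivative inverse (deriv H (\<psi> y))) (at y)"
    using regular_chart[OF z0(1) assms(5)] by metis
  define J where "J = I \<inter> z -` N"
  have J: "open J" "\<tau> \<in> J" using continuous_open_preimage[OF assms(2,1) N(1)] N(2) assms(4) by (auto simp: J_def)
  have inv: "\<psi> (H (z s)) = z s" if "s \<in> J" for s using that N(5) by (auto simp: J_def homeomorphism_def)
  have d: "(\<psi> has_field_derivative inverse (deriv H (z \<tau>))) (at (c + \<i> * of_real \<tau>))"
    using N(6)[of "H (z \<tau>)"] N(4) inv[OF J(2)] z0(2) by simp
  have lin: "((\<lambda>s. c + \<i> * of_real s) has_vector_derivative \<i>) (at \<tau>)"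
    by (auto intro!: derivative_eq_intros)
  have "((\<psi> \<circ> (\<lambda>s. c + \<i> * of_real s)) has_vector_derivative \<i> * inverse (deriv H (z \<tau>))) (at \<tau>)"
    by (rule field_vector_diff_chain_at[OF lin d])
  then show ?thesis
    by (rule has_vector_derivative_transform_within_open[OF _ J, THEN back_subst[of "\<lambda>d. (z has_vector_derivative d) (at \<tau>)"]])
       (use inv assms(3) in \<open>auto simp: J_def divide_inverse\<close>)
qed

text \<open>The flow equation is traded for a lifting problem: the vertical ray above
  \<open>H w\<close> is lifted through \<open>H\<close>. Where \<open>deriv H\<close> is nonzero,
  the lift has velocity \<open>\<i> / deriv H\<close>, a positive multiple of the gradient
  \<open>\<i> * cnj (deriv H)\<close>. Time 0 is exempt from regularity because \<open>w\<close>
  will be a saddle point.\<close>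

definition regular_lift :: "complex \<Rightarrow> real \<Rightarrow> (real \<Rightarrow> complex) \<Rightarrow> bool" where
  "regular_lift w T z \<longleftrightarrow> continuous_on {0..<T} z \<and> z 0 = w \<and>
     (\<forall>\<tau>\<in>{0..<T}. z \<tau> \<noteq> 0 \<and> H (z \<tau>) = H w + \<i> * of_real \<tau>) \<and>
     (\<forall>\<tau>\<in>{0<..<T}. deriv H (z \<tau>) \<noteq> 0)"

lemma regular_lift_continuous_on:
  "regular_lift w T z \<Longrightarrow> A \<subseteq> {0..<T} \<Longrightarrow> continuous_on A z"
  unfolding regular_lift_def using continuous_on_subset by blast

lemma regular_lift_flow:
  assumes "regular_lift w T z" "0 < \<tau>" "\<tau> < T"
  shows "\<exists>g k. GDERIV (\<lambda>w. Im (H w)) (z \<tau>) :> g \<and> k > 0 \<and>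
               (z has_vector_derivative k *\<^sub>R g) (at \<tau>)"
proof (intro exI conjI)
  have z: "z \<tau> \<noteq> 0" "deriv H (z \<tau>) \<noteq> 0" using assms by (auto simp: regular_lift_def)
  show "GDERIV (\<lambda>w. Im (H w)) (z \<tau>) :> \<i> * cnj (deriv H (z \<tau>))" by (rule GDERIV_Im_H[OF z(1)])
  show "0 < 1 / (norm (deriv H (z \<tau>)))\<^sup>2" using z by simp
  have "(z has_vector_derivative \<i> / deriv H (z \<tau>)) (at \<tau>)"
    by (rule lift_has_vector_derivative[of "{0<..<T}" z "H w"])
       (use assms z in \<open>auto simp: regular_lift_def intro: continuous_on_subset\<close>)
  moreover have "\<i> / deriv H (z \<tau>) = (1 / (norm (deriv H (z \<tau>)))\<^sup>2) *\<^sub>R (\<i> * cnj (deriv H (z \<tau>)))"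
    using z(2) by (simp add: complex_div_cnj[of \<i>] scaleR_conv_of_real)
  ultimately show "(z has_vector_derivative (1 / (norm (deriv H (z \<tau>)))\<^sup>2) *\<^sub>R (\<i> * cnj (deriv H (z \<tau>)))) (at \<tau>)"
    by metis
qed

lemma regular_lift_ascending: "regular_lift w T z \<Longrightarrow> ascending_curve H w {0..<T} z"
  using regular_lift_flow[of w T z] unfolding ascending_curve_def
  by (auto simp: regular_lift_def)

lemma regular_lift_ascending_total:
  assumes "\<And>T. regular_lift w T z"
  shows "ascending_curve H w {0..} z"
proof -
  have "continuous (at \<tau> within {0..}) z" if "\<tau> \<ge> 0" for \<tau>
  proof -
    have "at \<tau> within {0..} = at \<tau> within {0..<\<tau> + 1}"
      by (rule at_within_nhd[of _ "{..<\<tau>+1}"]) auto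
    then show ?thesis
      using assms[of "\<tau> + 1"] that by (auto simp: regular_lift_def continuous_on_eq_continuous_within)
  qed
  moreover have "z \<tau> \<noteq> 0 \<and> H (z \<tau>) = H w + \<i> * of_real \<tau>" if "\<tau> \<ge> 0" for \<tau>
    using assms[of "\<tau> + 1"] that by (auto simp: regular_lift_def)
  ultimately show ?thesis
    using regular_lift_flow[OF assms _ less_add_one] assms[of 1]
    unfolding ascending_curve_def by (auto simp: continuous_on_eq_continuous_within regular_lift_def)
qed

lemma regular_lift_restrict: "regular_lift w T z \<Longrightarrow> T' \<le> T \<Longrightarrow> regular_lift w T' z"
  unfolding regular_lift_def by (auto intro: continuous_on_subset)

lemma regular_lift_cong:
  assumes "regular_lift w T z" "\<And>\<tau>. 0 \<le> \<tau> \<Longrightarrow> \<tau> < T \<Longrightarrow> z' \<tau> = z \<tau>" "0 < T"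
  shows "regular_lift w T z'"
  using assms continuous_on_cong[of "{0..<T}" "{0..<T}" z z'] by (auto simp: regular_lift_def)

text \<open>Properness gives an accumulation point \<open>l\<close> over \<open>c\<close>. The zeros
  of \<open>H - c\<close> are isolated, so \<open>H - c\<close> is bounded away from 0 on small
  circles around \<open>l\<close>. Late enough the curve stays below that bound; it then cannot
  cross the circle and, being inside at some time, remains inside.\<close>

lemma lift_limit:
  fixes a T :: real
  assumes "a < T" and cont: "continuous_on {a..<T} z" and nz: "\<And>\<tau>. \<tau> \<in> {a..<T} \<Longrightarrow> z \<tau> \<noteq> 0"
    and lim: "((\<lambda>\<tau>. H (z \<tau>)) \<longlongrightarrow> c) (at_left T)"
  obtains l where "l \<noteq> 0" "H l = c" "(z \<longlongrightarrow> l) (at_left T)"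
proof -
  have near: "\<exists>b\<in>{a..<T}. \<forall>\<tau>. b < \<tau> \<and> \<tau> < T \<longrightarrow> norm (H (z \<tau>) - c) < e" if "e > 0" for e
  proof -
    have "eventually (\<lambda>\<tau>. dist (H (z \<tau>)) c < e) (at_left T)" using lim that by (rule tendstoD)
    then obtain b where b: "b < T" "\<And>\<tau>. b < \<tau> \<Longrightarrow> \<tau> < T \<Longrightarrow> dist (H (z \<tau>)) c < e"
      using eventually_at_left[OF \<open>a < T\<close>] by auto
    then show ?thesis using \<open>a < T\<close> by (intro bexI[of _ "max a b"]) (auto simp: dist_norm)
  qed
  obtain b where b: "b \<in> {a..<T}" "\<And>\<tau>. b < \<tau> \<Longrightarrow> \<tau> < T \<Longrightarrow> norm (H (z \<tau>) - c) < 1"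
    using near[of 1] by auto
  define s where "s n = T - (T - b) / real (n + 2)" for n
  have s: "b < s n" "s n < T" for n
  proof -
    have "(T - b) / real (n + 2) < (T - b) / 1"
      by (rule divide_strict_left_mono) (use b(1) in auto)
    moreover have "0 < (T - b) / real (n + 2)" using b(1) by auto
    ultimately show "b < s n" "s n < T" by (auto simp: s_def)
  qed
  have "(\<lambda>n. T - (T - b) / real (n + 2)) \<longlonglongrightarrow> T - 0"
    by (intro tendsto_intros LIMSEQ_ignore_initial_segment[OF lim_const_over_n])
  then have slim: "s \<longlonglongrightarrow> T" by (simp add: s_def[abs_def])
  have "norm (H (z (s n))) \<le> norm c + 1" for n
    using b(2)[OF s, of n] norm_triangle_ineq[of c "H (z (s n)) - c"] by simp
  moreover have "z (s n) \<noteq> 0" for n using s[of n] b(1) nz by auto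
  ultimately obtain l q where l: "l \<noteq> 0" "strict_mono q" "((\<lambda>n. z (s n)) \<circ> q) \<longlonglongrightarrow> l"
      "(\<lambda>n. H (z (s (q n)))) \<longlonglongrightarrow> H l"
    using convergent_subsequence[of "\<lambda>n. z (s n)"] by blast
  have slim': "filterlim (\<lambda>n. s (q n)) (at_left T) sequentially"
    unfolding filterlim_at
    using LIMSEQ_subseq_LIMSEQ[OF slim l(2)] s by (auto simp: o_def less_imp_neq)
  have "H l = c" using LIMSEQ_unique[OF l(4) filterlim_compose[OF lim slim']] .
  \<comment> \<open>The theorem on isolated zeros asks for a point at which \<open>H - c\<close>
    does not vanish.\<close>
  obtain \<beta> where \<beta>: "\<beta> \<noteq> 0" "H \<beta> \<noteq> c"
    using not_constant unfolding constant_on_def by blast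
  have "(\<lambda>z. H z - c) holomorphic_on - {0}" by (intro holomorphic_intros holo)
  then obtain r where r: "0 < r" "ball l r \<subseteq> - {0}" "\<And>z. z \<in> ball l r - {l} \<Longrightarrow> H z - c \<noteq> 0"
    using isolated_zeros[of "\<lambda>z. H z - c" "- {0}" l \<beta>] open_punctured connected_punctured l(1) \<open>H l = c\<close> \<beta>
    by auto
  have "(z \<longlongrightarrow> l) (at_left T)"
  proof (rule tendstoI)
    fix e :: real assume "e > 0"
    define \<rho> where "\<rho> = min e r / 2"
    have \<rho>: "0 < \<rho>" "\<rho> < e" "\<rho> < r" using \<open>e > 0\<close> r(1) by (auto simp: \<rho>_def)
    have sub: "sphere l \<rho> \<subseteq> ball l r - {l}" using \<rho> by auto
    then have sub0: "sphere l \<rho> \<subseteq> - {0}" using r(2) by blast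
    have "continuous_on (sphere l \<rho>) (\<lambda>z. norm (H z - c))"
      by (intro continuous_intros continuous_on_subset[OF continuous_H]) (use sub0 in auto)
    moreover have "compact (sphere l \<rho>)" "sphere l \<rho> \<noteq> {}" using \<rho>(1) by auto
    ultimately obtain x where x: "x \<in> sphere l \<rho>" "\<And>y. y \<in> sphere l \<rho> \<Longrightarrow> norm (H x - c) \<le> norm (H y - c)"
      using continuous_attains_inf[of "sphere l \<rho>" "\<lambda>z. norm (H z - c)"] by blast
    have "x \<in> ball l r - {l}" using x(1) sub by blast
    then have "norm (H x - c) > 0" using r(3)[of x] by auto
    then obtain d where d: "d \<in> {a..<T}" "\<And>\<tau>. d < \<tau> \<Longrightarrow> \<tau> < T \<Longrightarrow> norm (H (z \<tau>) - c) < norm (H x - c)"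
      using near by meson
    have off: "dist l (z \<tau>) \<noteq> \<rho>" if "\<tau> \<in> {d<..<T}" for \<tau>
      using x(2)[of "z \<tau>"] d(2)[of \<tau>] that by auto
    have "eventually (\<lambda>n. dist (z (s (q n))) l < \<rho>) sequentially"
      using tendstoD[OF l(3) \<rho>(1)] by (simp add: o_def)
    moreover have "eventually (\<lambda>n. d < s (q n)) sequentially"
      using order_tendstoD(1)[OF LIMSEQ_subseq_LIMSEQ[OF slim l(2)], of d] d(1) by (simp add: o_def)
    ultimately have "eventually (\<lambda>n. dist (z (s (q n))) l < \<rho> \<and> d < s (q n)) sequentially"
      by (rule eventually_conj)
    then obtain n where n: "dist (z (s (q n))) l < \<rho>" "d < s (q n)"
      by (auto simp: eventually_sequentially)
    have conn: "connected ((\<lambda>\<tau>. dist l (z \<tau>)) ` {d<..<T})"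
      by (intro connected_continuous_image continuous_intros continuous_on_subset[OF cont]) (use d(1) in auto)
    have "dist l (z \<tau>) < \<rho>" if \<tau>: "\<tau> \<in> {d<..<T}" for \<tau>
    proof (rule ccontr)
      assume "\<not> ?thesis"
      then have "\<rho> \<in> (\<lambda>\<tau>. dist l (z \<tau>)) ` {d<..<T}"
        using connectedD_interval[OF conn imageI[of "s (q n)"] imageI[OF \<tau>], of \<rho>] n s(2) 
        by (auto simp: dist_commute)
      then obtain \<tau>' where "\<tau>' \<in> {d<..<T}" "\<rho> = dist l (z \<tau>')" by (elim imageE)
      then show False using off by metis
    qed
    then show "eventually (\<lambda>\<tau>. dist (z \<tau>) l < e) (at_left T)"
      using \<rho>(2) d(1) eventually_at_left[of d T] by (force simp: dist_commute)
  qed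
  then show ?thesis using that l(1) \<open>H l = c\<close> by blast
qed

text \<open>The limit \<open>l\<close> at time \<open>T\<close> is higher than \<open>w\<close>, so
  it is not \<open>w\<close>; were it a saddle point, an ascending curve would end there. Hence
  \<open>H\<close> is invertible near \<open>l\<close>, and the local inverse continues the lift
  past \<open>T\<close>.\<close>

lemma regular_lift_extend:
  assumes z: "regular_lift w T z" and "T > 0"
    and no_end: "\<And>w'. saddle_point H w' \<Longrightarrow> w' \<noteq> w \<Longrightarrow> \<not> ascending_curve_ends_at H w w'"
  obtains T' z' where "T < T'" "regular_lift w T' z'" "\<And>\<tau>. 0 \<le> \<tau> \<Longrightarrow> \<tau> < T \<Longrightarrow> z' \<tau> = z \<tau>"
proof -
  define c where "c \<tau> = H w + \<i> * of_real \<tau>" for \<tau>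
  have contz: "continuous_on {0..<T} z" and z0: "z 0 = w"
    and zH: "\<And>\<tau>. 0 \<le> \<tau> \<Longrightarrow> \<tau> < T \<Longrightarrow> z \<tau> \<noteq> 0 \<and> H (z \<tau>) = c \<tau>"
    and zreg: "\<And>\<tau>. 0 < \<tau> \<Longrightarrow> \<tau> < T \<Longrightarrow> deriv H (z \<tau>) \<noteq> 0"
    using z by (auto simp: regular_lift_def c_def)
  have contc: "continuous_on A c" for A unfolding c_def[abs_def] by (intro continuous_intros)
  have "(c \<longlongrightarrow> c T) (at_left T)" unfolding c_def[abs_def] by (intro tendsto_intros)
  moreover have "eventually (\<lambda>\<tau>. c \<tau> = H (z \<tau>)) (at_left T)"
    unfolding eventually_at_left[OF \<open>T > 0\<close>] using \<open>T > 0\<close> zH by (intro exI[of _ 0]) auto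
  ultimately have "((\<lambda>\<tau>. H (z \<tau>)) \<longlongrightarrow> c T) (at_left T)"
    by (rule Lim_transform_eventually)
  then obtain l where l: "l \<noteq> 0" "H l = c T" "(z \<longlongrightarrow> l) (at_left T)"
    using lift_limit[of 0 T z "c T"] \<open>T > 0\<close> contz zH by auto
  have "deriv H l \<noteq> 0"
  proof
    assume "deriv H l = 0"
    then have "saddle_point H l" using l(1) by (simp add: saddle_point_def)
    moreover have "l \<noteq> w" using l(2) \<open>T > 0\<close> by (auto simp: c_def)
    moreover have "ascending_curve_ends_at H w l"
      using regular_lift_ascending[OF z] \<open>T > 0\<close> l(3) by (auto simp: ascending_curve_ends_at_def)
    ultimately show False using no_end by blast
  qed
  then obtain N e \<psi> where N: "open N" "l \<in> N" "N \<subseteq> - {0}" "e > 0"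
    "homeomorphism N (ball (c T) e) H \<psi>" "continuous_on (ball (c T) e) \<psi>"
    "\<And>y. y \<in> ball (c T) e \<Longrightarrow> deriv H (\<psi> y) \<noteq> 0 \<and>
       (\<psi> has_field_derivative inverse (deriv H (\<psi> y))) (at y)"
    using regular_chart[OF l(1)] unfolding l(2) by metis
  have "eventually (\<lambda>\<tau>. z \<tau> \<in> N) (at_left T)" using l(3) N(1,2) topological_tendstoD by blast
  then obtain b0 where b0: "b0 < T" "\<And>\<tau>. b0 < \<tau> \<Longrightarrow> \<tau> < T \<Longrightarrow> z \<tau> \<in> N"
    unfolding eventually_at_left[OF \<open>T > 0\<close>] by auto
  define b where "b = max (max 0 b0) (T - e)"
  have b: "0 \<le> b" "b < T" "b0 \<le> b" "T - e \<le> b" using b0(1) \<open>T > 0\<close> N(4) by (auto simp: b_def)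
  \<comment> \<open>From \<open>T\<close> on, \<open>z'\<close> follows the local inverse along the
    vertical line. For \<open>b < \<tau> < T\<close> both formulas agree, which gives continuity at
    \<open>T\<close>.\<close>
  define z' where "z' \<tau> = (if \<tau> < T then z \<tau> else \<psi> (c \<tau>))" for \<tau>
  have cball: "c \<tau> \<in> ball (c T) e" if "b < \<tau>" "\<tau> < T + e" for \<tau>
  proof -
    have "c T - c \<tau> = \<i> * of_real (T - \<tau>)" by (simp add: c_def algebra_simps)
    then have "dist (c T) (c \<tau>) = \<bar>T - \<tau>\<bar>"
      by (simp only: dist_norm norm_mult norm_of_real norm_ii mult_1_left)
    then show ?thesis using that b by auto
  qed
  have z'\<psi>: "z' \<tau> = \<psi> (c \<tau>)" if "b < \<tau>" for \<tau>
  proof (cases "\<tau> < T")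
    case True
    then have "z \<tau> \<in> N" using b0(2)[of \<tau>] that b by auto
    then have "\<psi> (H (z \<tau>)) = z \<tau>" using N(5) by (auto simp: homeomorphism_def)
    then show ?thesis using zH[of \<tau>] that b True by (simp add: z'_def)
  qed (simp add: z'_def)
  have U: "{0..<T + e} = {0..<T} \<union> {b<..<T + e}" using b N(4) by auto
  have "continuous_on ({0..<T} \<union> {b<..<T + e}) z'"
  proof (rule continuous_on_Un_local_open)
    show "openin (top_of_set ({0..<T} \<union> {b<..<T + e})) {0..<T}"
      unfolding openin_open using b by (intro exI[of _ "{..<T}"]) auto
    show "openin (top_of_set ({0..<T} \<union> {b<..<T + e})) {b<..<T + e}"
      unfolding openin_open using b by (intro exI[of _ "{b<..<T+e}"]) auto
    show "continuous_on {0..<T} z'" using contz by (rule continuous_on_cong[THEN iffD1, rotated 2]) (auto simp: z'_def)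
    have "continuous_on {b<..<T + e} (\<lambda>\<tau>. \<psi> (c \<tau>))"
      using cball by (intro continuous_on_compose2[OF N(6) contc]) auto
    then show "continuous_on {b<..<T + e} z'"
      by (rule continuous_on_cong[THEN iffD1, rotated 2]) (auto simp: z'\<psi>)
  qed
  then have "continuous_on {0..<T + e} z'" using U by simp
  moreover have "z' 0 = w" using \<open>T > 0\<close> z0 by (simp add: z'_def)
  moreover have "z' \<tau> \<noteq> 0 \<and> H (z' \<tau>) = c \<tau> \<and> (\<tau> > 0 \<longrightarrow> deriv H (z' \<tau>) \<noteq> 0)" if "\<tau> \<in> {0..<T + e}" for \<tau>
  proof (cases "\<tau> < T")
    case True
    then show ?thesis using zH[of \<tau>] zreg[of \<tau>] that by (simp add: z'_def)
  next
    case False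
    then have "b < \<tau>" "c \<tau> \<in> ball (c T) e" using that b cball by auto
    then show ?thesis using z'\<psi> N(3,5) N(7)[of "c \<tau>"] by (auto simp: homeomorphism_def)
  qed
  ultimately have "regular_lift w (T + e) z'" by (simp add: regular_lift_def c_def)
  then show ?thesis using that[of "T + e" z'] N(4) by (simp add: z'_def)
qed

text \<open>Two different lifts start at a saddle point, so agreement at time 0 is not enough.
  Agreement on an initial interval is, since all positive times are regular.\<close>

lemma regular_lift_unique:
  assumes "regular_lift w T z" "regular_lift w T z'" "0 < T0" "T0 \<le> T"
    and "\<And>\<tau>. 0 \<le> \<tau> \<Longrightarrow> \<tau> < T0 \<Longrightarrow> z \<tau> = z' \<tau>" and "0 \<le> \<tau>" "\<tau> < T"
  shows "z \<tau> = z' \<tau>"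
proof (cases "\<tau> = 0")
  case False
  show ?thesis
  proof (rule lift_unique[of "{0<..<T}" z z' "T0 / 2"])
    show "continuous_on {0<..<T} z" by (rule regular_lift_continuous_on[OF assms(1)]) auto
    show "continuous_on {0<..<T} z'" by (rule regular_lift_continuous_on[OF assms(2)]) auto
  qed (use assms False in \<open>auto simp: regular_lift_def\<close>)
qed (use assms in auto)

lemma regular_lift_Sup:
  assumes "0 < s" "\<And>T. T < s \<Longrightarrow> regular_lift w T z"
  shows "regular_lift w s z"
proof -
  have *: "regular_lift w ((\<tau> + s) / 2) z" "\<tau> < (\<tau> + s) / 2" if "\<tau> < s" for \<tau>
    using that by (auto intro!: assms)
  have "continuous (at \<tau> within {0..<s}) z" if "\<tau> \<in> {0..<s}" for \<tau>
  proof -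
    have "at \<tau> within {0..<s} = at \<tau> within {0..<(\<tau> + s) / 2}"
      by (rule at_within_nhd[of _ "{..<(\<tau> + s) / 2}"]) (use that in auto)
    then show ?thesis
      using *[of \<tau>] that by (auto simp: regular_lift_def continuous_on_eq_continuous_within)
  qed
  moreover have "z \<tau> \<noteq> 0 \<and> H (z \<tau>) = H w + \<i> * of_real \<tau> \<and> (0 < \<tau> \<longrightarrow> deriv H (z \<tau>) \<noteq> 0)"
    if "0 \<le> \<tau>" "\<tau> < s" for \<tau>
    using *[of \<tau>] that unfolding regular_lift_def by auto
  moreover have "z 0 = w" using assms(1) *(1)[of 0] by (simp add: regular_lift_def)
  ultimately show ?thesis
    by (simp add: regular_lift_def continuous_on_eq_continuous_within)
qed

text \<open>Uniqueness makes all extensions of \<open>z0\<close> compatible, so they glue to one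
  curve. Their end times are unbounded: at a finite supremum the glued curve is itself a lift, and
  \<open>regular_lift_extend\<close> would continue it.\<close>

lemma regular_lift_total:
  assumes z0: "regular_lift w T0 z0" and "T0 > 0"
    and no_end: "\<And>w'. saddle_point H w' \<Longrightarrow> w' \<noteq> w \<Longrightarrow> \<not> ascending_curve_ends_at H w w'"
  obtains z where "ascending_curve H w {0..} z" "\<And>\<tau>. 0 \<le> \<tau> \<Longrightarrow> \<tau> < T0 \<Longrightarrow> z \<tau> = z0 \<tau>"
proof -
  define X where "X = {T. T0 \<le> T \<and> (\<exists>z. regular_lift w T z \<and> (\<forall>\<tau>. 0 \<le> \<tau> \<and> \<tau> < T0 \<longrightarrow> z \<tau> = z0 \<tau>))}"
  have "\<forall>T\<in>X. \<exists>z. regular_lift w T z \<and> (\<forall>\<tau>. 0 \<le> \<tau> \<and> \<tau> < T0 \<longrightarrow> z \<tau> = z0 \<tau>)" by (auto simp: X_def)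
  then obtain Z where Z: "\<And>T. T \<in> X \<Longrightarrow> regular_lift w T (Z T)"
      "\<And>T \<tau>. T \<in> X \<Longrightarrow> 0 \<le> \<tau> \<Longrightarrow> \<tau> < T0 \<Longrightarrow> Z T \<tau> = z0 \<tau>"
    by metis
  have T0X: "T0 \<in> X" using z0 by (auto simp: X_def)
  have agree: "Z T \<tau> = Z T' \<tau>" if "T \<in> X" "T' \<in> X" "0 \<le> \<tau>" "\<tau> < T" "\<tau> < T'" for T T' \<tau>
  proof (rule regular_lift_unique[of w "min T T'" _ _ T0])
    show "regular_lift w (min T T') (Z T)" "regular_lift w (min T T') (Z T')"
      by (rule regular_lift_restrict[OF Z(1)]; use that in simp)+
    show "T0 \<le> min T T'" using that by (auto simp: X_def)
  qed (use that Z(2) \<open>T0 > 0\<close> in auto)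
  define z where "z \<tau> = Z (SOME T. T \<in> X \<and> \<tau> < T) \<tau>" for \<tau>
  have zZ: "z \<tau> = Z T \<tau>" if "T \<in> X" "0 \<le> \<tau>" "\<tau> < T" for T \<tau>
  proof -
    have "(SOME T. T \<in> X \<and> \<tau> < T) \<in> X \<and> \<tau> < (SOME T. T \<in> X \<and> \<tau> < T)"
      by (rule someI[of _ T]) (use that in auto)
    then show ?thesis unfolding z_def using agree that by blast
  qed
  have lift: "regular_lift w T z" if "T \<in> X" for T
    using Z(1)[OF that] by (rule regular_lift_cong) (use zZ that \<open>T0 > 0\<close> in \<open>auto simp: X_def\<close>)
  have init: "z \<tau> = z0 \<tau>" if "0 \<le> \<tau>" "\<tau> < T0" for \<tau>
    using zZ[OF T0X] Z(2)[OF T0X] that by simp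
  have "\<not> bdd_above X"
  proof
    assume bdd: "bdd_above X"
    define s where "s = Sup X"
    have "T0 \<le> s" unfolding s_def by (rule cSup_upper[OF T0X bdd])
    have "regular_lift w s z"
    proof (rule regular_lift_Sup)
      show "0 < s" using \<open>T0 \<le> s\<close> \<open>T0 > 0\<close> by simp
      fix T assume "T < s"
      then obtain T' where T': "T' \<in> X" "T < T'" using less_cSupD[of X T] T0X s_def by auto
      then show "regular_lift w T z" using lift[OF T'(1)] regular_lift_restrict by auto
    qed
    from regular_lift_extend[OF this _ no_end]
    obtain s' z' where s': "s < s'" "regular_lift w s' z'" "\<And>\<tau>. 0 \<le> \<tau> \<Longrightarrow> \<tau> < s \<Longrightarrow> z' \<tau> = z \<tau>"
      using \<open>T0 \<le> s\<close> \<open>T0 > 0\<close> by auto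
    then have "s' \<in> X" using init \<open>T0 \<le> s\<close> by (auto simp: X_def)
    then have "s' \<le> s" unfolding s_def by (rule cSup_upper[OF _ bdd])
    then show False using s'(1) by simp
  qed
  have "regular_lift w T z" for T
  proof -
    obtain T' where "T' \<in> X" "T < T'" using \<open>\<not> bdd_above X\<close> unfolding bdd_above_def by (metis not_le)
    then show ?thesis using lift regular_lift_restrict by (metis less_imp_le)
  qed
  then show ?thesis using that regular_lift_ascending_total init by blast
qed

end

subsection \<open>Saddle points at the pass\<close>

text \<open>For \<open>s = 1\<close> and \<open>s = -1\<close> these are the two parts of the disc
  on which the square has positive real part; in a saddle chart they are the two hills that face
  each other at the saddle point.\<close>

definition sector :: "real \<Rightarrow> real \<Rightarrow> complex set" where
  "sector e s = ball 0 e \<inter> {\<zeta>. \<bar>Im \<zeta>\<bar> < s * Re \<zeta>}"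

lemma connected_sector: "connected (sector e s)"
proof -
  have "sector e s = ball 0 e \<inter> ({\<zeta>. Im \<zeta> - s * Re \<zeta> < 0} \<inter> {\<zeta>. - Im \<zeta> - s * Re \<zeta> < 0})"
    by (auto simp: sector_def)
  also have "{\<zeta>. Im \<zeta> - s * Re \<zeta> < 0} = {\<zeta>. inner (Complex (- s) 1) \<zeta> < 0}"
    by (auto simp: inner_complex_def)
  also have "{\<zeta>. - Im \<zeta> - s * Re \<zeta> < 0} = {\<zeta>. inner (Complex (- s) (- 1)) \<zeta> < 0}"
    by (auto simp: inner_complex_def)
  finally show ?thesis by (auto intro!: convex_connected convex_Int convex_halfspace_lt)
qed

lemma Re_square_pos_iff: "0 < Re (\<zeta>\<^sup>2) \<longleftrightarrow> \<bar>Im \<zeta>\<bar> < \<bar>Re \<zeta>\<bar>"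
proof -
  have "Re (\<zeta>\<^sup>2) = (Re \<zeta>)\<^sup>2 - (Im \<zeta>)\<^sup>2" by (simp add: power2_eq_square)
  then show ?thesis using abs_le_square_iff[of "Re \<zeta>" "Im \<zeta>"] by (auto simp: not_le)
qed

lemma sectors:
  assumes "\<zeta> \<in> ball 0 e" "0 < Re (\<zeta>\<^sup>2)"
  obtains s :: real where "s \<in> {1, -1}" "\<zeta> \<in> sector e s"
proof (cases "0 < Re \<zeta>")
  case True
  then show ?thesis using that[of 1] assms by (auto simp: Re_square_pos_iff sector_def)
next
  case False
  then show ?thesis using that[of "-1"] assms by (auto simp: Re_square_pos_iff sector_def)
qed

lemma sector_Re_square_pos: "s \<in> {1, -1} \<Longrightarrow> \<zeta> \<in> sector e s \<Longrightarrow> 0 < Re (\<zeta>\<^sup>2)"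
  by (auto simp: Re_square_pos_iff sector_def)

context proper_on_punctured_plane
begin

lemma inner_hill_high:
  assumes "inner_hill h \<inter> outer_hill h = {}" "u \<in> inner_hill h" "circle_max < Im (H u)"
  shows "norm u < 1"
proof (rule ccontr)
  assume "\<not> ?thesis"
  moreover have "norm u \<noteq> 1"
    using assms(3) norm_ne_1[of u] abs_Im_le_cmod[of "H u"] by linarith
  ultimately have "u \<in> outer_hill h" using assms hill_subset by (intro steep_in_hill) auto
  then show False using assms by auto
qed

lemma outer_hill_high:
  assumes "inner_hill h \<inter> outer_hill h = {}" "u \<in> outer_hill h" "circle_max < Im (H u)"
  shows "1 < norm u"
proof (rule ccontr)
  assume "\<not> ?thesis"
  moreover have "norm u \<noteq> 1"
    using assms(3) norm_ne_1[of u] abs_Im_le_cmod[of "H u"] by linarith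
  ultimately have "u \<in> inner_hill h" using assms hill_subset by (intro steep_in_hill) auto
  then show False using assms by auto
qed

text \<open>By continuity a point of the closures is not lower than \<open>h\<close>. If it were
  higher, it would lie in one of the hills, which is open and therefore misses the closure of the
  other.\<close>

lemma pass_height:
  assumes disj: "inner_hill h \<inter> outer_hill h = {}"
    and w: "w \<noteq> 0" "w \<in> closure (inner_hill h)" "w \<in> closure (outer_hill h)"
  shows "Im (H w) = h"
proof (rule antisym)
  show "h \<le> Im (H w)"
  proof (rule ccontr)
    assume "\<not> ?thesis"
    then have "w \<in> {z. z \<noteq> 0 \<and> H z \<in> {y. Im y < h}}" using w by auto
    moreover have "open {z. z \<noteq> 0 \<and> H z \<in> {y. Im y < h}}"
      by (intro open_preimage open_halfspace_Im_lt)
    ultimately have "{z. z \<noteq> 0 \<and> H z \<in> {y. Im y < h}} \<inter> inner_hill h \<noteq> {}"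
      using w(2) open_Int_closure_eq_empty by blast
    then show False using hill_subset by (force simp: superlevel_def)
  qed
  show "Im (H w) \<le> h"
  proof (rule ccontr)
    assume "\<not> ?thesis"
    then have "w \<in> superlevel h" using w by (auto simp: superlevel_def)
    then have "w \<in> inner_hill h \<or> w \<in> outer_hill h" using superlevel_eq_hills by auto
    moreover have "inner_hill h \<inter> closure (outer_hill h) = {}"
      using disj open_Int_closure_eq_empty[OF open_hill] by blast
    moreover have "outer_hill h \<inter> closure (inner_hill h) = {}"
      using disj open_Int_closure_eq_empty[OF open_hill] by blast
    ultimately show False using w by auto
  qed
qed

text \<open>Around a regular point a chart turns the superlevel set into a disc cut by a half plane;
  this is connected and so belongs to a single hill.\<close>

lemma pass_critical:
  assumes disj: "inner_hill h \<inter> outer_hill h = {}"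
    and w: "w \<noteq> 0" "w \<in> closure (inner_hill h)" "w \<in> closure (outer_hill h)"
  shows "deriv H w = 0"
proof (rule ccontr)
  assume "deriv H w \<noteq> 0"
  then obtain N e \<psi> where N: "open N" "w \<in> N" "N \<subseteq> - {0}" "e > 0"
    "homeomorphism N (ball (H w) e) H \<psi>" "continuous_on (ball (H w) e) \<psi>"
    using regular_chart[OF w(1)] by metis
  define C where "C = \<psi> ` (ball (H w) e \<inter> {y. h < Im y})"
  have "connected C" unfolding C_def
    by (intro connected_continuous_image continuous_on_subset[OF N(6)] convex_connected
        convex_Int convex_halfspace_Im_gt) auto
  have C: "C = N \<inter> superlevel h"
  proof
    show "C \<subseteq> N \<inter> superlevel h"
      using N(3,5) by (auto simp: C_def superlevel_def homeomorphism_def)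
    show "N \<inter> superlevel h \<subseteq> C"
    proof
      fix z assume "z \<in> N \<inter> superlevel h"
      then have "z = \<psi> (H z)" "H z \<in> ball (H w) e \<inter> {y. h < Im y}"
        using N(5) by (auto simp: superlevel_def homeomorphism_def)
      then show "z \<in> C" unfolding C_def by blast
    qed
  qed
  have "N \<inter> inner_hill h \<noteq> {}" "N \<inter> outer_hill h \<noteq> {}"
    using w(2,3) N(2) open_Int_closure_eq_empty[OF N(1), of "inner_hill h"]
      open_Int_closure_eq_empty[OF N(1), of "outer_hill h"] by auto
  then obtain u v where "u \<in> N" "u \<in> inner_hill h" "v \<in> N" "v \<in> outer_hill h" by auto
  moreover from this have "u \<in> C" "v \<in> C" using C hill_subset by auto
  ultimately have "C \<subseteq> inner_hill h" "v \<in> C"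
    using hill_connected[of u _ h C] C \<open>connected C\<close> by auto
  with \<open>v \<in> outer_hill h\<close> disj show False by auto
qed

text \<open>In the chart the superlevel set consists of the two sectors. Each is connected, hence
  inside one hill once it meets it; both hills come close to \<open>w\<close>, so each of them owns
  a sector, and disjointness makes the two sectors different.\<close>

lemma pass_saddle_sectors:
  assumes disj: "inner_hill h \<inter> outer_hill h = {}"
    and w: "w \<noteq> 0" "w \<in> closure (inner_hill h)" "w \<in> closure (outer_hill h)"
    and chart: "saddle_chart H w N e g \<psi>" and N0: "N \<subseteq> - {0}"
  obtains s where "s \<in> {1, -1}" "\<psi> ` sector e s \<subseteq> inner_hill h" "\<psi> ` sector e (- s) \<subseteq> outer_hill h"
proof -
  have hw: "Im (H w) = h" by (rule pass_height[OF disj w])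
  define \<phi> where "\<phi> z = (z - w) * g z" for z
  have N: "open N" "w \<in> N" "N \<subseteq> - {0}" "\<And>z. z \<in> N \<Longrightarrow> H z = H w + \<i> * (\<phi> z)\<^sup>2"
      "homeomorphism N (ball 0 e) \<phi> \<psi>"
    using saddle_chartD[OF chart] N0 unfolding \<phi>_def[abs_def] by blast+
  have inv: "\<psi> (\<phi> z) = z" "\<phi> z \<in> ball 0 e" if "z \<in> N" for z
    using N(5) that by (auto simp: homeomorphism_def)
  have inv': "\<phi> (\<psi> y) = y" "\<psi> y \<in> N" if "y \<in> ball 0 e" for y
    using N(5) that by (auto simp: homeomorphism_def)
  have ImH: "Im (H z) = h + Re ((\<phi> z)\<^sup>2)" if "z \<in> N" for z
    using N(4)[OF that] hw by simp
  have sup: "\<psi> ` sector e s \<subseteq> superlevel h" if s: "s \<in> {1, -1}" for s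
  proof
    fix z assume "z \<in> \<psi> ` sector e s"
    then obtain y where y: "y \<in> sector e s" "z = \<psi> y" by auto
    then have "y \<in> ball 0 e" by (simp add: sector_def)
    then show "z \<in> superlevel h"
      using ImH[of z] inv'[of y] y sector_Re_square_pos[OF s y(1)] N(3) by (auto simp: superlevel_def)
  qed
  have conn: "connected (\<psi> ` sector e s)" for s
    using N(5) by (intro connected_continuous_image connected_sector)
       (auto simp: homeomorphism_def sector_def intro: continuous_on_subset)
  \<comment> \<open>Nonemptiness is recorded to rule out that both hills own the same
    sector.\<close>
  have ex: "\<exists>s\<in>{1, -1}. \<psi> ` sector e s \<subseteq> hill P h \<and> sector e s \<noteq> {}" if "w \<in> closure (hill P h)" for P
  proof -
    have "N \<inter> hill P h \<noteq> {}"
      using that N(2) open_Int_closure_eq_empty[OF N(1), of "hill P h"] by auto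
    then obtain u where u: "u \<in> N" "u \<in> hill P h" by auto
    then have "0 < Re ((\<phi> u)\<^sup>2)" using ImH[OF u(1)] hill_subset by (force simp: superlevel_def)
    then obtain s where s: "s \<in> {1, -1 :: real}" "\<phi> u \<in> sector e s" using sectors inv(2)[OF u(1)] by metis
    have "u \<in> \<psi> ` sector e s" using s(2) inv(1)[OF u(1)] by force
    then show ?thesis using hill_connected[OF u(2) conn sup[OF s(1)]] s by blast
  qed
  obtain s where s: "s \<in> {1, -1}" "\<psi> ` sector e s \<subseteq> inner_hill h" "sector e s \<noteq> {}" using ex w(2) by blast
  obtain s' where s': "s' \<in> {1, -1}" "\<psi> ` sector e s' \<subseteq> outer_hill h" using ex w(3) by blast
  have "s \<noteq> s'" using s s' disj by blast
  then have "s' = - s" using s(1) s'(1) by auto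
  then show ?thesis using that s s' by blast
qed

text \<open>In the chart coordinate the curve is \<open>s * sqrt \<tau>\<close>, whose square is
  \<open>\<tau>\<close>; the sign \<open>s\<close> selects one of the two ascending curves. There
  \<open>H\<close> reads \<open>H w + \<i> * y\<^sup>2\<close>, which is critical only at
  \<open>y = 0\<close>, so the curve is a regular lift and can be continued to all times.\<close>

lemma saddle_curve:
  assumes w: "w \<noteq> 0" and s: "s \<in> {1, -1 :: real}"
    and chart: "saddle_chart H w N e g \<psi>" and N0: "N \<subseteq> - {0}"
    and no_end: "\<And>w'. saddle_point H w' \<Longrightarrow> w' \<noteq> w \<Longrightarrow> \<not> ascending_curve_ends_at H w w'"
  obtains z where "ascending_curve H w {0..} z"
    "\<And>\<tau>. 0 \<le> \<tau> \<Longrightarrow> \<tau> < e\<^sup>2 \<Longrightarrow> z \<tau> = \<psi> (of_real (s * sqrt \<tau>))"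
proof -
  define \<phi> where "\<phi> z = (z - w) * g z" for z
  have N: "open N" "w \<in> N" "N \<subseteq> - {0}" "e > 0"
      "\<And>z. z \<in> N \<Longrightarrow> H z = H w + \<i> * (\<phi> z)\<^sup>2"
      "homeomorphism N (ball 0 e) \<phi> \<psi>" "\<psi> holomorphic_on ball 0 e"
    using saddle_chartD[OF chart] N0 unfolding \<phi>_def[abs_def] by blast+
  have "\<phi> w = 0" by (simp add: \<phi>_def)
  have inv': "\<phi> (\<psi> y) = y" "\<psi> y \<in> N" if "y \<in> ball 0 e" for y
    using N(6) that by (auto simp: homeomorphism_def)
  define z where "z \<tau> = \<psi> (of_real (s * sqrt \<tau>))" for \<tau>
  have inb: "complex_of_real (s * sqrt \<tau>) \<in> ball 0 e" if "0 \<le> \<tau>" "\<tau> < e\<^sup>2" for \<tau>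
    using that s N(4) real_sqrt_less_mono[of \<tau> "e\<^sup>2"] by (auto simp: norm_mult)
  have sq: "(complex_of_real (s * sqrt \<tau>))\<^sup>2 = of_real \<tau>" if "0 \<le> \<tau>" for \<tau>
    using s that by (auto simp: power2_eq_square simp flip: of_real_mult)
  have "H (z \<tau>) = H w + \<i> * of_real \<tau>" "z \<tau> \<noteq> 0" if "0 \<le> \<tau>" "\<tau> < e\<^sup>2" for \<tau>
    using N(5)[OF inv'(2)[OF inb[OF that]]] inv'[OF inb[OF that]] sq[OF that(1)] N(3)
    by (auto simp: z_def simp del: of_real_mult)
  moreover have "deriv H (z \<tau>) \<noteq> 0" if "0 < \<tau>" "\<tau> < e\<^sup>2" for \<tau>
  proof
    let ?y = "complex_of_real (s * sqrt \<tau>)"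
    assume 0: "deriv H (z \<tau>) = 0"
    have y: "?y \<in> ball 0 e" "?y \<noteq> 0" using that inb s by auto
    have "\<psi> ?y \<noteq> 0" using inv'(2)[OF y(1)] N(3) by auto
    moreover have "(\<psi> has_field_derivative deriv \<psi> ?y) (at ?y)"
      using N(7) y(1) holomorphic_derivI open_ball by blast
    ultimately have "((H \<circ> \<psi>) has_field_derivative deriv H (\<psi> ?y) * deriv \<psi> ?y) (at ?y)"
      by (intro DERIV_chain has_derivative_H)
    then have "((H \<circ> \<psi>) has_field_derivative 0) (at ?y)" using 0 by (simp add: z_def)
    moreover have "eventually (\<lambda>x. (H \<circ> \<psi>) x = H w + \<i> * x\<^sup>2) (nhds ?y)"
      unfolding eventually_nhds using N(5) inv' y(1)
      by (intro exI[of _ "ball 0 e"]) auto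
    ultimately have "((\<lambda>x. H w + \<i> * x\<^sup>2) has_field_derivative 0) (at ?y)"
      by (subst (asm) DERIV_cong_ev[OF refl _ refl]) simp_all
    moreover have "((\<lambda>x. H w + \<i> * x\<^sup>2) has_field_derivative \<i> * (2 * ?y)) (at ?y)"
      by (auto intro!: derivative_eq_intros)
    ultimately have "\<i> * (2 * ?y) = 0" using DERIV_unique by blast
    then show False using y(2) by simp
  qed
  moreover have "continuous_on {0..<e\<^sup>2} z" unfolding z_def[abs_def]
    by (rule continuous_on_compose2[OF holomorphic_on_imp_continuous_on[OF N(7)]])
       (use inb in \<open>auto intro!: continuous_intros simp del: of_real_mult\<close>)
  moreover have "z 0 = w" using N(2,6) \<open>\<phi> w = 0\<close> by (auto simp: z_def homeomorphism_def)
  ultimately have "regular_lift w (e\<^sup>2) z" by (auto simp: regular_lift_def)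
  from regular_lift_total[OF this _ no_end] show ?thesis
    using that N(4) unfolding z_def by (metis zero_less_power)
qed

lemma ascending_curve_start: "ascending_curve H w {0..} z \<Longrightarrow> (z \<longlongrightarrow> w) (at_right 0)"
proof -
  assume z: "ascending_curve H w {0..} z"
  then have "(z \<longlongrightarrow> w) (at 0 within {0..})"
    by (auto simp: ascending_curve_def continuous_on_def)
  then show ?thesis by (rule tendsto_within_subset) auto
qed

lemma ascending_curve_height:
  "ascending_curve H w {0..} z \<Longrightarrow> \<tau> \<ge> 0 \<Longrightarrow> z \<tau> \<noteq> 0 \<and> H (z \<tau>) = H w + \<i> * of_real \<tau>"
  by (auto simp: ascending_curve_def)

lemma connected_ascending_curve: "ascending_curve H w {0..} z \<Longrightarrow> connected (z ` {0<..})"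
  unfolding ascending_curve_def
  by (intro connected_continuous_image[OF continuous_on_subset[of "{0..}" z]]) auto

lemma ascending_curve_in_hill:
  assumes z: "ascending_curve H w {0..} z" and T: "T > 0" "z T \<in> hill P (Im (H w))" and "\<tau> > 0"
  shows "z \<tau> \<in> hill P (Im (H w))"
proof -
  have "z ` {0<..} \<subseteq> superlevel (Im (H w))"
    using ascending_curve_height[OF z] by (auto simp: superlevel_def)
  from hill_connected[OF T(2) connected_ascending_curve[OF z] this] show ?thesis using assms by auto
qed

lemma pass_relevant:
  assumes nondeg: "\<And>z. saddle_point H z \<Longrightarrow> nondegenerate H z"
    and no_end: "\<And>z z'. saddle_point H z \<Longrightarrow> saddle_point H z' \<Longrightarrow> z' \<noteq> z \<Longrightarrow>
           \<not> ascending_curve_ends_at H z z'"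
    and disj: "inner_hill h \<inter> outer_hill h = {}"
    and w: "w \<noteq> 0" "w \<in> closure (inner_hill h)" "w \<in> closure (outer_hill h)"
  shows "relevant_saddle_point H w"
proof -
  have dw: "deriv H w = 0" by (rule pass_critical[OF disj w])
  then have sw: "saddle_point H w" using w by (simp add: saddle_point_def)
  then have ddw: "deriv (deriv H) w \<noteq> 0" using nondeg by (simp add: nondegenerate_def)
  have wm: "w \<in> - {0}" using w(1) by simp
  obtain N e g \<psi> where N: "N \<subseteq> - {0}" "saddle_chart H w N e g \<psi>"
    using saddle_chart_exists[OF holo open_punctured wm dw ddw] by blast
  have "e > 0" using saddle_chartD(3)[OF N(2)] .
  obtain s where s: "s \<in> {1, -1}" "\<psi> ` sector e s \<subseteq> inner_hill h" "\<psi> ` sector e (- s) \<subseteq> outer_hill h"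
    using pass_saddle_sectors[OF disj w N(2,1)] by blast
  have hw: "Im (H w) = h" by (rule pass_height[OF disj w])
  have curve: "\<exists>z. ascending_curve H w {0..} z \<and> (\<forall>\<tau>>0. z \<tau> \<in> hill P h)"
    if s: "s \<in> {1, -1}" "\<psi> ` sector e s \<subseteq> hill P h" for s P
  proof -
    obtain z where z: "ascending_curve H w {0..} z"
      "\<And>\<tau>. 0 \<le> \<tau> \<Longrightarrow> \<tau> < e\<^sup>2 \<Longrightarrow> z \<tau> = \<psi> (of_real (s * sqrt \<tau>))"
      using saddle_curve[OF w(1) s(1) N(2,1) no_end[OF sw]] by blast
    \<comment> \<open>The curve has this chart coordinate at time \<open>e\<^sup>2 / 4\<close>.
      Connectedness of the curve carries the hill from this single time to all positive
      times.\<close>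
    define x where "x = complex_of_real (s * (e / 2))"
    have "x \<in> sector e s" using s(1) \<open>e > 0\<close> by (auto simp: x_def sector_def)
    moreover have "z (e\<^sup>2 / 4) = \<psi> x"
    proof -
      have "sqrt (e\<^sup>2 / 4) = e / 2" using \<open>e > 0\<close> by (simp add: real_sqrt_divide)
      moreover have "0 \<le> e\<^sup>2 / 4" "e\<^sup>2 / 4 < e\<^sup>2" using \<open>e > 0\<close> by auto
      ultimately show ?thesis using z(2) by (simp only: x_def)
    qed
    ultimately have "z (e\<^sup>2 / 4) \<in> hill P (Im (H w))" using s(2) hw by auto
    then have "z \<tau> \<in> hill P h" if "\<tau> > 0" for \<tau>
      using ascending_curve_in_hill[OF z(1) _ _ that, of "e\<^sup>2 / 4"] \<open>e > 0\<close> hw by simp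
    then show ?thesis using z(1) by auto
  qed
  obtain zp where zp: "ascending_curve H w {0..} zp" "\<forall>\<tau>>0. zp \<tau> \<in> inner_hill h"
    using curve[OF s(1,2)] by auto
  obtain zm where zm: "ascending_curve H w {0..} zm" "\<forall>\<tau>>0. zm \<tau> \<in> outer_hill h"
    using curve[OF _ s(3)] s(1) by auto
  \<comment> \<open>Beyond this time both curves are higher than \<open>circle_max\<close>, where
    the unit circle separates the two hills.\<close>
  have "eventually (\<lambda>\<tau>. (norm (zp \<tau>) - 1) * (norm (zm \<tau>) - 1) < 0) at_top"
    using eventually_gt_at_top[of "max 0 (circle_max - h)"]
  proof eventually_elim
    case (elim \<tau>)
    have "Im (H (zp \<tau>)) = h + \<tau>" "Im (H (zm \<tau>)) = h + \<tau>"
      using ascending_curve_height[OF zp(1), of \<tau>] ascending_curve_height[OF zm(1), of \<tau>] elim hw by auto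
    then have "norm (zp \<tau>) < 1" "1 < norm (zm \<tau>)"
      using inner_hill_high[OF disj, of "zp \<tau>"] outer_hill_high[OF disj, of "zm \<tau>"] zp(2) zm(2) elim by auto
    then show ?case by (simp add: mult_neg_pos)
  qed
  then show ?thesis unfolding relevant_saddle_point_def using sw zp(1) zm(1) by blast
qed



text \<open>The two curves in the definition of relevance come with no link to a chart. One late
  time is enough: there they are above \<open>circle_max\<close> on opposite sides of the unit
  circle, hence in hills of different kind, and each curve stays in its hill by
  connectedness.\<close>

lemma relevant_hill_curves:
  assumes "relevant_saddle_point H w"
  obtains zi zo where "ascending_curve H w {0..} zi" "\<And>\<tau>. \<tau> > 0 \<Longrightarrow> zi \<tau> \<in> inner_hill (Im (H w))"
    "ascending_curve H w {0..} zo" "\<And>\<tau>. \<tau> > 0 \<Longrightarrow> zo \<tau> \<in> outer_hill (Im (H w))"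
proof -
  obtain zp zm where z: "ascending_curve H w {0..} zp" "ascending_curve H w {0..} zm"
    and ev: "eventually (\<lambda>\<tau>. (norm (zp \<tau>) - 1) * (norm (zm \<tau>) - 1) < 0) at_top"
    using assms by (auto simp: relevant_saddle_point_def)
  have "eventually (\<lambda>\<tau>. (norm (zp \<tau>) - 1) * (norm (zm \<tau>) - 1) < 0 \<and> max 0 (circle_max - Im (H w)) < \<tau>) at_top"
    using ev eventually_gt_at_top by (rule eventually_conj)
  from eventually_happens'[OF trivial_limit_at_top_linorder this]
  obtain T where T: "(norm (zp T) - 1) * (norm (zm T) - 1) < 0" "0 < T" "circle_max < Im (H w) + T"
    by auto
  have "zT \<in> hill P (Im (H w))" if "ascending_curve H w {0..} zz" "zT = zz T" "P zT" for zz zT P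
    using ascending_curve_height[OF that(1), of T] that T
    by (auto simp: hill_def superlevel_def intro!: exI[of _ zT])
  then have *: "zz \<tau> \<in> hill P (Im (H w))" if "ascending_curve H w {0..} zz" "P (zz T)" "\<tau> > 0" for zz P \<tau>
    using ascending_curve_in_hill[OF that(1) T(2) _ that(3)] that by blast
  consider "norm (zp T) < 1" "norm (zm T) > 1" | "norm (zm T) < 1" "norm (zp T) > 1"
    using T(1) by (auto simp: mult_less_0_iff)
  then show ?thesis
  proof cases
    case 1
    then show ?thesis using that[of zp zm] z * by auto
  next
    case 2
    then show ?thesis using that[of zm zp] z * by auto
  qed
qed

lemma hill_curve_closure:
  assumes "ascending_curve H w {0..} z" "\<And>\<tau>. \<tau> > 0 \<Longrightarrow> z \<tau> \<in> hill P h"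
  shows "w \<in> closure (hill P h)"
proof (rule Lim_in_closed_set[OF closed_closure _ _ ascending_curve_start[OF assms(1)]])
  show "eventually (\<lambda>\<tau>. z \<tau> \<in> closure (hill P h)) (at_right 0)"
    using eventually_at_right_less[of 0]
    by eventually_elim (use assms(2) closure_subset[of "hill P h"] in blast)
qed auto

lemma bounded_on_annulus:
  assumes "0 < r"
  obtains K where "\<And>z. r \<le> norm z \<Longrightarrow> norm z \<le> R \<Longrightarrow> norm (H z) \<le> K"
proof -
  have "compact (cball 0 R - ball (0::complex) r)" by (intro compact_diff) auto
  then have "compact (H ` (cball 0 R - ball 0 r))"
    by (intro compact_continuous_image continuous_on_subset[OF continuous_H]) (use assms in auto)
  then obtain K where "\<forall>y\<in>H ` (cball 0 R - ball 0 r). norm y \<le> K"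
    using compact_imp_bounded bounded_iff by metis
  then show ?thesis using that[of K] by auto
qed

lemma inner_curve_tends_to_0:
  assumes disj: "inner_hill (Im (H w)) \<inter> outer_hill (Im (H w)) = {}"
    and z: "ascending_curve H w {0..} z" "\<And>\<tau>. \<tau> > 0 \<Longrightarrow> z \<tau> \<in> inner_hill (Im (H w))" and "r > 0"
  obtains \<tau> where "\<tau> > 0" "norm (z \<tau>) < r"
proof -
  obtain K where K: "\<And>z. r \<le> norm z \<Longrightarrow> norm z \<le> 1 \<Longrightarrow> norm (H z) \<le> K"
    using bounded_on_annulus[OF \<open>r > 0\<close>] by metis
  \<comment> \<open>At this time the height exceeds \<open>circle_max\<close>, so the curve is
    inside the unit circle, and also exceeds the bound \<open>K\<close> on the annulus between
    \<open>r\<close> and 1, so it has left the annulus inwards.\<close>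
  define \<tau> where "\<tau> = \<bar>circle_max\<bar> + \<bar>K\<bar> + \<bar>Im (H w)\<bar> + 1"
  have "\<tau> > 0" by (simp add: \<tau>_def add_nonneg_pos)
  have "Im (H (z \<tau>)) = Im (H w) + \<tau>" using ascending_curve_height[OF z(1), of \<tau>] \<open>\<tau> > 0\<close> by simp
  then have "Im (H (z \<tau>)) > circle_max" "Im (H (z \<tau>)) > K" by (auto simp: \<tau>_def)
  moreover from this have "norm (z \<tau>) < 1" using inner_hill_high[OF disj z(2)] \<open>\<tau> > 0\<close> by auto
  ultimately have "norm (z \<tau>) < r" using K[of "z \<tau>"] abs_Im_le_cmod[of "H (z \<tau>)"] by argo
  then show ?thesis using that \<open>\<tau> > 0\<close> by auto
qed

lemma outer_curve_tends_to_infinity: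
  assumes disj: "inner_hill (Im (H w)) \<inter> outer_hill (Im (H w)) = {}"
    and z: "ascending_curve H w {0..} z" "\<And>\<tau>. \<tau> > 0 \<Longrightarrow> z \<tau> \<in> outer_hill (Im (H w))"
  obtains \<tau> where "\<tau> > 0" "norm (z \<tau>) > R"
proof -
  obtain K where K: "\<And>z. 1 \<le> norm z \<Longrightarrow> norm z \<le> R \<Longrightarrow> norm (H z) \<le> K"
    using bounded_on_annulus[of 1] by (metis zero_less_one)
  define \<tau> where "\<tau> = \<bar>circle_max\<bar> + \<bar>K\<bar> + \<bar>Im (H w)\<bar> + 1"
  have "\<tau> > 0" by (simp add: \<tau>_def add_nonneg_pos)
  have "Im (H (z \<tau>)) = Im (H w) + \<tau>" using ascending_curve_height[OF z(1), of \<tau>] \<open>\<tau> > 0\<close> by simp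
  then have "Im (H (z \<tau>)) > circle_max" "Im (H (z \<tau>)) > K" by (auto simp: \<tau>_def)
  moreover from this have "norm (z \<tau>) > 1" using outer_hill_high[OF disj z(2)] \<open>\<tau> > 0\<close> by auto
  ultimately have "norm (z \<tau>) > R" using K[of "z \<tau>"] abs_Im_le_cmod[of "H (z \<tau>)"] by argo
  then show ?thesis using that \<open>\<tau> > 0\<close> by auto
qed

text \<open>Removing from the chart disc only the closed sector on the side of \<open>s\<close>
  leaves a set that is star-shaped about a point of the opposite sector and contains both valleys.
  The valleys are thus joined across the opposite sector, which is free of this hill.\<close>

lemma avoid_hill_near_saddle:
  assumes chart: "saddle_chart H w N e g \<psi>" and N0: "N \<subseteq> - {0}" and s: "s \<in> {1, -1}"
    and other: "\<psi> ` sector e (- s) \<inter> hill P (Im (H w)) = {}"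
    and pq: "p \<in> N" "q \<in> N" "Im (H p) < Im (H w)" "Im (H q) < Im (H w)"
  shows "connected_component (- (closure (hill P (Im (H w))) \<union> {0})) p q"
proof -
  define \<phi> where "\<phi> z = (z - w) * g z" for z
  have N: "open N" "w \<in> N" "e > 0" "\<And>z. z \<in> N \<Longrightarrow> H z = H w + \<i> * (\<phi> z)\<^sup>2"
      "homeomorphism N (ball 0 e) \<phi> \<psi>"
    using saddle_chartD[OF chart] unfolding \<phi>_def[abs_def] by blast+
  have inv: "\<psi> (\<phi> z) = z" "\<phi> z \<in> ball 0 e" if "z \<in> N" for z
    using N(5) that by (auto simp: homeomorphism_def)
  have inv': "\<phi> (\<psi> y) = y" "\<psi> y \<in> N" if "y \<in> ball 0 e" for y
    using N(5) that by (auto simp: homeomorphism_def)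
  \<comment> \<open>The strict inequality makes \<open>Y\<close> open and leaves out the apex, so
    that the image misses the closure of the hill and not only the hill.\<close>
  define Y where "Y = ball 0 e \<inter> {\<zeta>. s * Re \<zeta> < \<bar>Im \<zeta>\<bar>}"
  have "starlike Y" unfolding starlike_def
  proof (intro bexI ballI)
    define a where "a = complex_of_real (- s * e / 2)"
    show aY: "a \<in> Y" using s N(3) by (auto simp: Y_def a_def)
    fix y assume y: "y \<in> Y"
    show "closed_segment a y \<subseteq> Y"
    proof
      fix x assume x: "x \<in> closed_segment a y"
      then have "x \<in> ball 0 e"
        using closed_segment_subset[of a "ball 0 e" y] aY y by (auto simp: Y_def)
      moreover obtain u where u: "0 \<le> u" "u \<le> 1" "x = (1 - u) *\<^sub>R a + u *\<^sub>R y"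
        using x by (auto simp: closed_segment_def)
      have "s * Re x < \<bar>Im x\<bar>"
      proof (cases "u = 0")
        case True
        then show ?thesis using aY u by (auto simp: Y_def)
      next
        case False
        have "Im a = 0" by (simp add: a_def)
        then have "Im x = u * Im y" using u(3) by simp
        then have "\<bar>Im x\<bar> = u * \<bar>Im y\<bar>" using u(1) by (simp add: abs_mult)
        moreover have "s * Re x = u * (s * Re y) - (1 - u) * (e / 2)"
          using s by (auto simp: u(3) a_def field_simps)
        moreover have "u * (s * Re y) < u * \<bar>Im y\<bar>" using y False u by (auto simp: Y_def)
        moreover have "0 \<le> (1 - u) * (e / 2)" using u N(3) by simp
        ultimately show ?thesis by linarith
      qed
      ultimately show "x \<in> Y" by (simp add: Y_def)
    qed
  qed
  then have "connected Y" by (rule starlike_imp_connected)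
  have Ysub: "Y \<subseteq> ball 0 e" by (auto simp: Y_def)
  define C where "C = \<psi> ` Y"
  have "connected C" unfolding C_def using \<open>connected Y\<close> N(5) Ysub
    by (intro connected_continuous_image) (auto simp: homeomorphism_def elim: continuous_on_subset)
  have Ceq: "C = N \<inter> \<phi> -` Y"
  proof
    show "C \<subseteq> N \<inter> \<phi> -` Y" using inv' Ysub by (auto simp: C_def)
    show "N \<inter> \<phi> -` Y \<subseteq> C" unfolding C_def using inv by force
  qed
  have "open Y" unfolding Y_def by (intro open_Int open_ball open_Collect_less continuous_intros)
  then have "open C" unfolding Ceq
    using N(1,5) by (intro continuous_open_preimage) (auto simp: homeomorphism_def)
  have "C \<inter> hill P (Im (H w)) = {}"
  proof (rule ccontr)
    assume "\<not> ?thesis"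
    then obtain u where u: "u \<in> N" "\<phi> u \<in> Y" "u \<in> hill P (Im (H w))" using Ceq by auto
    then have "Im (H w) < Im (H u)" using hill_subset by (auto simp: superlevel_def)
    then have "0 < Re ((\<phi> u)\<^sup>2)" using N(4)[OF u(1)] by simp
    then obtain s' where s': "s' \<in> {1, -1 :: real}" "\<phi> u \<in> sector e s'" using sectors inv(2)[OF u(1)] by metis
    have "s' \<noteq> s" using s'(2) u(2) by (auto simp: Y_def sector_def)
    then have "s' = - s" using s s'(1) by auto
    then have "u \<in> \<psi> ` sector e (- s)" using s'(2) inv(1)[OF u(1)] by force
    then show False using other u(3) by auto
  qed
  then have "C \<inter> closure (hill P (Im (H w))) = {}" using open_Int_closure_eq_empty[OF \<open>open C\<close>] by auto
  then have "C \<subseteq> - (closure (hill P (Im (H w))) \<union> {0})" using Ceq N0 by auto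
  moreover have "x \<in> C" if "x \<in> N" "Im (H x) < Im (H w)" for x
  proof -
    have "Re ((\<phi> x)\<^sup>2) < 0" using N(4)[OF that(1)] that(2) by simp
    then have "Im (\<phi> x) \<noteq> 0 \<and> (Re (\<phi> x))\<^sup>2 < (Im (\<phi> x))\<^sup>2" by (auto simp: power2_eq_square)
    then have "\<bar>Re (\<phi> x)\<bar> < \<bar>Im (\<phi> x)\<bar>" using abs_le_square_iff[of "Im (\<phi> x)" "Re (\<phi> x)"] by auto
    then have "\<phi> x \<in> Y" using inv(2)[OF that(1)] s by (auto simp: Y_def)
    then show ?thesis using Ceq that by auto
  qed
  ultimately show ?thesis unfolding connected_component_def using \<open>connected C\<close> pq by blast
qed

end

section \<open>Separation by the hills above the dominant saddle point\<close>

locale dominant_saddle = proper_on_punctured_plane +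
  fixes zs :: complex
  assumes nondeg: "\<And>z. saddle_point H z \<Longrightarrow> nondegenerate H z"
    and no_end: "\<And>z z'. saddle_point H z \<Longrightarrow> saddle_point H z' \<Longrightarrow> z' \<noteq> z \<Longrightarrow>
           \<not> ascending_curve_ends_at H z z'"
    and dominant: "unique_dominant_saddle_point H zs"
begin

lemma relevant_zs: "relevant_saddle_point H zs"
  using dominant by (simp add: unique_dominant_saddle_point_def)

lemma relevant_unique: "relevant_saddle_point H z \<Longrightarrow> Im (H zs) \<le> Im (H z) \<Longrightarrow> z = zs"
  using dominant by (force simp: unique_dominant_saddle_point_def)

lemma zs: "zs \<noteq> 0" "deriv H zs = 0" "deriv (deriv H) zs \<noteq> 0"
  using relevant_zs nondeg[of zs]
  by (auto simp: relevant_saddle_point_def saddle_point_def nondegenerate_def)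

abbreviation "h0 \<equiv> Im (H zs)"

lemma hills_disjoint: "inner_hill h0 \<inter> outer_hill h0 = {}"
proof (rule ccontr)
  assume "\<not> ?thesis"
  then obtain h w where h: "h0 < h" "inner_hill h \<inter> outer_hill h = {}"
    "w \<noteq> 0" "w \<in> closure (inner_hill h)" "w \<in> closure (outer_hill h)"
    using mountain_pass by metis
  then have "Im (H w) = h" "relevant_saddle_point H w"
    using pass_height pass_relevant[OF nondeg no_end] by auto
  with relevant_unique[of w] h show False by auto
qed

lemma zs_in_closures: "zs \<in> closure (inner_hill h0)" "zs \<in> closure (outer_hill h0)"
  using relevant_hill_curves[OF relevant_zs] hill_curve_closure by metis+

text \<open>A common nonzero point of the closures is a relevant saddle point at height
  \<open>h0\<close>, and strict dominance leaves only \<open>zs\<close>. Near 0 the superlevel set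
  is entirely inner, so adjoining 0 creates no further intersection.\<close>

lemma closures_meet: "(closure (inner_hill h0) \<union> {0}) \<inter> closure (outer_hill h0) = {zs}"
proof
  obtain r R where rR: "0 < r" "r < R"
    "\<And>u. u \<in> superlevel h0 \<Longrightarrow> norm u < r \<Longrightarrow> u \<in> inner_hill h0"
    using hills_near_ends by metis
  have "ball 0 r \<inter> outer_hill h0 = {}"
    using rR(3) hill_subset hills_disjoint by force
  then have "ball 0 r \<inter> closure (outer_hill h0) = {}" using open_Int_closure_eq_empty[OF open_ball] by blast
  moreover have "0 \<in> ball (0::complex) r" using rR(1) by simp
  ultimately have 0: "0 \<notin> closure (outer_hill h0)" by blast
  show "(closure (inner_hill h0) \<union> {0}) \<inter> closure (outer_hill h0) \<subseteq> {zs}"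
  proof
    fix w assume "w \<in> (closure (inner_hill h0) \<union> {0}) \<inter> closure (outer_hill h0)"
    then have w: "w \<noteq> 0" "w \<in> closure (inner_hill h0)" "w \<in> closure (outer_hill h0)" using 0 by auto
    then show "w \<in> {zs}"
      using pass_height[OF hills_disjoint w] pass_relevant[OF nondeg no_end hills_disjoint w]
        relevant_unique[of w] by simp
  qed
  show "{zs} \<subseteq> (closure (inner_hill h0) \<union> {0}) \<inter> closure (outer_hill h0)"
    using zs_in_closures by auto
qed

lemma compact_inner: "compact (closure (inner_hill h0) \<union> {0})"
proof -
  obtain r R where rR: "0 < r" "r < R"
    "\<And>u. u \<in> superlevel h0 \<Longrightarrow> R < norm u \<Longrightarrow> u \<in> outer_hill h0"
    using hills_near_ends by metis
  have "inner_hill h0 \<subseteq> cball 0 R"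
  proof
    fix u assume u: "u \<in> inner_hill h0"
    then have "u \<in> superlevel h0" "u \<notin> outer_hill h0" using hill_subset hills_disjoint by auto
    then show "u \<in> cball 0 R" using rR(3)[of u] by (auto simp: not_less[symmetric])
  qed
  then have "bounded (inner_hill h0)" using bounded_cball bounded_subset by blast
  then show ?thesis by (intro compact_Un) (auto simp: compact_closure)
qed

text \<open>Neither closed set alone separates the two valleys, since each can be passed through the
  sector of the other. Their intersection is a point, hence connected, so by Janiszewski's theorem
  the union does not separate them either; off the union the height is below
  \<open>h0\<close>.\<close>

lemma below_connected:
  assumes chart: "saddle_chart H zs N e g \<psi>" and N0: "N \<subseteq> - {0}"
    and s: "s \<in> {1, -1}" "\<psi> ` sector e s \<subseteq> inner_hill h0" "\<psi> ` sector e (- s) \<subseteq> outer_hill h0"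
    and pq: "p \<in> N" "q \<in> N" "Im (H p) < h0" "Im (H q) < h0"
  shows "connected_component {z. z \<noteq> 0 \<and> Im (H z) < h0} p q"
proof -
  have "connected_component (- (closure (inner_hill h0) \<union> {0})) p q"
    by (rule avoid_hill_near_saddle[OF chart N0 s(1) _ pq]) (use s hills_disjoint in blast)
  moreover have "connected_component (- (closure (outer_hill h0) \<union> {0})) p q"
    by (rule avoid_hill_near_saddle[OF chart N0 _ _ pq, of "- s"]) (use s hills_disjoint in auto)
  then have "connected_component (- closure (outer_hill h0)) p q"
    by (rule connected_component_of_subset) auto
  moreover have "connected ((closure (inner_hill h0) \<union> {0}) \<inter> closure (outer_hill h0))"
    unfolding closures_meet by simp
  ultimately have "connected_component (- ((closure (inner_hill h0) \<union> {0}) \<union> closure (outer_hill h0))) p q"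
    using Janiszewski[OF compact_inner closed_closure] by metis
  then show ?thesis
    by (rule connected_component_of_subset) (use level_in_closure_hills[of _ h0] in \<open>force simp: not_le[symmetric]\<close>)
qed

end

subsection \<open>Two limits along a segment\<close>

text \<open>Seen from a point near its midpoint, the segment spans an angle close to
  \<open>pi\<close>, counted positively on the left of \<open>v\<close> and negatively on the right.
  This half turn on either side is the jump of the winding number across the contour.\<close>

lemma winding_number_segment_limit:
  fixes z :: "real \<Rightarrow> complex" and w v :: complex and \<epsilon> \<sigma> :: real
  assumes v: "v \<noteq> 0" and \<epsilon>: "\<epsilon> > 0" and \<sigma>: "\<sigma> \<in> {1, -1}"
    and lim: "(z \<longlongrightarrow> w) F"
    and side: "eventually (\<lambda>\<tau>. 0 < \<sigma> * Im ((z \<tau> - w) / v)) F"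
  shows "((\<lambda>\<tau>. winding_number (linepath (w - of_real \<epsilon> * v) (w + of_real \<epsilon> * v)) (z \<tau>))
           \<longlongrightarrow> of_real (\<sigma> / 2)) F"
proof -
  let ?L = "linepath (w - of_real \<epsilon> * v) (w + of_real \<epsilon> * v)"
  define \<alpha> where "\<alpha> a = (a - w) / v" for a
  \<comment> \<open>The factor \<open>\<i> * \<sigma>\<close> carries
    \<open>(\<zeta> - a) / v\<close>, for \<open>\<zeta>\<close> on the segment, into the right half
    plane, where \<open>Ln\<close> is holomorphic and provides a primitive.\<close>
  define W where "W b = (Ln (\<i> * of_real \<sigma> * (of_real \<epsilon> - b)) - Ln (\<i> * of_real \<sigma> * (- of_real \<epsilon> - b)))
      / (2 * of_real pi * \<i>)" for b
  have formula: "winding_number ?L a = W (\<alpha> a)" if a: "0 < \<sigma> * Im (\<alpha> a)" for a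
  proof -
    have ReP: "0 < Re (\<i> * of_real \<sigma> * ((\<zeta> - a) / v))" if \<zeta>: "\<zeta> \<in> path_image ?L" for \<zeta>
    proof -
      obtain u where u: "\<zeta> = (1 - u) *\<^sub>R (w - of_real \<epsilon> * v) + u *\<^sub>R (w + of_real \<epsilon> * v)"
        using \<zeta> by (auto simp: closed_segment_def)
      have "\<zeta> = w + of_real ((2 * u - 1) * \<epsilon>) * v"
        by (simp add: u scaleR_conv_of_real algebra_simps)
      then have "(\<zeta> - a) / v = of_real ((2 * u - 1) * \<epsilon>) - \<alpha> a"
        using v by (simp add: \<alpha>_def field_simps)
      then have "Re (\<i> * of_real \<sigma> * ((\<zeta> - a) / v)) = \<sigma> * Im (\<alpha> a)"
        by simp
      then show ?thesis using a by simp
    qed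
    have nin: "a \<notin> path_image ?L" using ReP[of a] by auto
    have "((\<lambda>\<zeta>. 1 / (\<zeta> - a)) has_contour_integral
        (Ln (\<i> * of_real \<sigma> * ((pathfinish ?L - a) / v)) - Ln (\<i> * of_real \<sigma> * ((pathstart ?L - a) / v)))) ?L"
    proof (rule contour_integral_primitive[where S = "path_image ?L"])
      fix \<zeta> assume \<zeta>: "\<zeta> \<in> path_image ?L"
      have ne: "\<zeta> \<noteq> a" using \<zeta> nin by auto
      have notin: "\<i> * of_real \<sigma> * ((\<zeta> - a) / v) \<notin> \<real>\<^sub>\<le>\<^sub>0"
        using ReP[OF \<zeta>] by (auto simp: complex_nonpos_Reals_iff)
      have "\<sigma> \<noteq> 0" using \<sigma> by auto
      show "((\<lambda>\<zeta>. Ln (\<i> * of_real \<sigma> * ((\<zeta> - a) / v))) has_field_derivative 1 / (\<zeta> - a)) (at \<zeta> within path_image ?L)"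
        using notin ne v \<open>\<sigma> \<noteq> 0\<close>
        by (auto intro!: derivative_eq_intros simp: field_simps)
    qed auto
    moreover have "(pathfinish ?L - a) / v = of_real \<epsilon> - \<alpha> a" "(pathstart ?L - a) / v = - of_real \<epsilon> - \<alpha> a"
      using v by (auto simp: \<alpha>_def field_simps)
    ultimately have "contour_integral ?L (\<lambda>\<zeta>. 1 / (\<zeta> - a)) =
        Ln (\<i> * of_real \<sigma> * (of_real \<epsilon> - \<alpha> a)) - Ln (\<i> * of_real \<sigma> * (- of_real \<epsilon> - \<alpha> a))"
      using contour_integral_unique by metis
    then show ?thesis using winding_number_valid_path[OF _ nin] by (simp add: W_def)
  qed
  have \<alpha>lim: "((\<lambda>\<tau>. \<alpha> (z \<tau>)) \<longlongrightarrow> 0) F"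
    unfolding \<alpha>_def using lim v by (auto intro!: tendsto_eq_intros)
  have "((\<lambda>\<tau>. W (\<alpha> (z \<tau>))) \<longlongrightarrow> W 0) F"
    unfolding W_def
    by (intro tendsto_intros \<alpha>lim) (use \<epsilon> \<sigma> in \<open>auto simp: complex_nonpos_Reals_iff\<close>)
  moreover have "W 0 = of_real (\<sigma> / 2)"
  proof -
    have L: "Ln (\<i> * of_real \<epsilon>) = of_real (ln \<epsilon>) + \<i> * (of_real pi / 2)"
        "Ln (- (\<i> * of_real \<epsilon>)) = of_real (ln \<epsilon>) - \<i> * (of_real pi / 2)"
      using Ln_times_of_real[OF \<epsilon>, of \<i>] Ln_times_of_real[OF \<epsilon>, of "- \<i>"]
      by (auto simp: mult.commute Ln_of_real[OF \<epsilon>])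
    show ?thesis using \<sigma> by (auto simp: W_def L field_simps)
  qed
  ultimately have "((\<lambda>\<tau>. W (\<alpha> (z \<tau>))) \<longlongrightarrow> of_real (\<sigma> / 2)) F" by simp
  then show ?thesis
    by (rule Lim_transform_eventually)
       (use side in eventually_elim, auto simp: formula \<alpha>_def)
qed

lemma integral_gaussian: "integrable lborel (\<lambda>x :: real. exp (- x\<^sup>2))" "(LBINT x :: real. exp (- x\<^sup>2)) = sqrt pi"
proof -
  have "has_bochner_integral lborel (\<lambda>x :: real. exp (- x\<^sup>2)) (2 *\<^sub>R (sqrt pi / 2))"
    by (rule has_bochner_integral_even_function[OF gaussian_moment_0]) simp
  then show "integrable lborel (\<lambda>x :: real. exp (- x\<^sup>2))" "(LBINT x :: real. exp (- x\<^sup>2)) = sqrt pi"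
    by (auto simp: has_bochner_integral_iff)
qed

lemma integrable_gaussian_half: "integrable lborel (\<lambda>y :: real. exp (- y\<^sup>2 / 2))"
  using lborel_integrable_real_affine[OF integral_gaussian(1), of "1 / sqrt 2" 0]
  by (simp add: power_divide)

lemma laplace_asymptotics:
  fixes F k :: "real \<Rightarrow> complex"
  assumes \<epsilon>: "\<epsilon> > 0" and contF: "continuous_on {-\<epsilon>..\<epsilon>} F" and contk: "continuous_on {-\<epsilon>..\<epsilon>} k"
    and k0: "k 0 = -1" and kneg: "\<And>x. x \<in> {-\<epsilon>..\<epsilon>} \<Longrightarrow> Re (k x) \<le> - 1 / 2"
  shows "((\<lambda>t. of_real (sqrt t) * integral {-\<epsilon>..\<epsilon>} (\<lambda>x. F x * exp (of_real (t * x\<^sup>2) * k x)))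
           \<longlongrightarrow> of_real (sqrt pi) * F 0) at_top"
proof -
  define \<Phi> where "\<Phi> t x = indicator {-\<epsilon>..\<epsilon>} x *\<^sub>R (F x * exp (of_real (t * x\<^sup>2) * k x))" for t x :: real
  define s where "s t y = \<Phi> t (y / sqrt t)" for t y
  define f where "f y = F 0 * of_real (exp (- y\<^sup>2))" for y :: real
  have cont: "continuous_on {-\<epsilon>..\<epsilon>} (\<lambda>x. F x * exp (of_real (t * x\<^sup>2) * k x))" for t
    by (intro continuous_intros contF contk)
  have meas: "\<Phi> t \<in> borel_measurable borel" for t
    unfolding \<Phi>_def[abs_def] by (rule borel_measurable_continuous_on_indicator[OF _ cont]) auto
  have smeas: "s t \<in> borel_measurable lborel" for t
    unfolding s_def[abs_def] using meas[of t] by measurable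
  have scale: "of_real (sqrt t) * integral {-\<epsilon>..\<epsilon>} (\<lambda>x. F x * exp (of_real (t * x\<^sup>2) * k x)) = integral\<^sup>L lborel (s t)"
    if t: "t > 0" for t
  proof -
    have "integral {-\<epsilon>..\<epsilon>} (\<lambda>x. F x * exp (of_real (t * x\<^sup>2) * k x)) = integral\<^sup>L lborel (\<Phi> t)"
      using set_borel_integral_eq_integral(2)[OF borel_integrable_atLeastAtMost'[OF cont[of t]]]
      by (simp add: \<Phi>_def[abs_def] set_lebesgue_integral_def)
    also have "\<dots> = \<bar>1 / sqrt t\<bar> *\<^sub>R integral\<^sup>L lborel (\<lambda>y. \<Phi> t (0 + 1 / sqrt t * y))"
      by (rule lborel_integral_real_affine) (use t in auto)
    also have "\<dots> = (1 / sqrt t) *\<^sub>R integral\<^sup>L lborel (s t)"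
      using t by (simp add: s_def[abs_def])
    finally show ?thesis using t by (simp add: scaleR_conv_of_real)
  qed
  have "bounded (F ` {-\<epsilon>..\<epsilon>})"
    by (intro compact_imp_bounded compact_continuous_image contF) auto
  then obtain B where B: "\<And>x. x \<in> {-\<epsilon>..\<epsilon>} \<Longrightarrow> norm (F x) \<le> B" "0 \<le> B"
    unfolding bounded_iff by (metis abs_ge_zero abs_of_nonneg imageI norm_ge_zero order_trans abs_ge_self)
  have "((\<lambda>t. integral\<^sup>L lborel (s t)) \<longlongrightarrow> integral\<^sup>L lborel f) at_top"
  proof (rule integral_dominated_convergence_at_top)
    show "f \<in> borel_measurable lborel" unfolding f_def[abs_def] by measurable
    show "s t \<in> borel_measurable lborel" for t by (rule smeas)
    show "integrable lborel (\<lambda>y. B * exp (- y\<^sup>2 / 2))" using integrable_gaussian_half by auto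
    show "eventually (\<lambda>t. AE y in lborel. norm (s t y) \<le> B * exp (- y\<^sup>2 / 2)) at_top"
      using eventually_gt_at_top[of 0]
    proof eventually_elim
      case (elim t)
      have "norm (s t y) \<le> B * exp (- y\<^sup>2 / 2)" for y
      proof (cases "y / sqrt t \<in> {-\<epsilon>..\<epsilon>}")
        case True
        let ?x = "y / sqrt t"
        have sq: "t * ?x\<^sup>2 = y\<^sup>2" using elim by (simp add: power_divide)
        have "norm (s t y) = norm (F ?x) * exp (y\<^sup>2 * Re (k ?x))"
          using True by (simp add: s_def \<Phi>_def sq norm_mult)
        also have "\<dots> \<le> B * exp (- y\<^sup>2 / 2)"
          using B True kneg[OF True] mult_left_mono[OF kneg[OF True], of "y\<^sup>2"] by (intro mult_mono) auto
        finally show ?thesis .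
      qed (use B(2) in \<open>auto simp: s_def \<Phi>_def\<close>)
      then show ?case by simp
    qed
    show "AE y in lborel. ((\<lambda>t. s t y) \<longlongrightarrow> f y) at_top"
    proof (rule AE_I2)
      fix y :: real
      have x0: "((\<lambda>t. y / sqrt t) \<longlongrightarrow> 0) at_top"
        by (intro real_tendsto_divide_at_top[OF tendsto_const] sqrt_at_top)
      have within: "eventually (\<lambda>t. y / sqrt t \<in> {-\<epsilon>..\<epsilon>}) at_top"
      proof -
        have "eventually (\<lambda>t. y / sqrt t \<in> {-\<epsilon><..<\<epsilon>}) at_top"
          using x0 by (rule topological_tendstoD) (use \<epsilon> in auto)
        then show ?thesis by eventually_elim auto
      qed
      have lim: "((\<lambda>t. g (y / sqrt t)) \<longlongrightarrow> g 0) at_top" if "continuous_on {-\<epsilon>..\<epsilon>} g" for g :: "real \<Rightarrow> complex"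
        using continuous_on_tendsto_compose[OF that x0 _ within] \<epsilon> by auto
      have "((\<lambda>t. F (y / sqrt t) * exp (of_real (y\<^sup>2) * k (y / sqrt t))) \<longlongrightarrow> F 0 * exp (of_real (y\<^sup>2) * k 0)) at_top"
        by (intro tendsto_intros lim contF contk)
      also have "F 0 * exp (of_real (y\<^sup>2) * k 0) = f y"
        by (simp add: f_def k0 flip: exp_of_real)
      finally show "((\<lambda>t. s t y) \<longlongrightarrow> f y) at_top"
      proof (rule Lim_transform_eventually)
        show "eventually (\<lambda>t. F (y / sqrt t) * exp (of_real (y\<^sup>2) * k (y / sqrt t)) = s t y) at_top"
          using within eventually_gt_at_top[of 0]
        proof eventually_elim
          case (elim t)
          have sq: "t * (y / sqrt t)\<^sup>2 = y\<^sup>2" using elim by (simp add: power_divide)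
          show ?case using elim by (simp add: s_def \<Phi>_def sq)
        qed
      qed
    qed
  qed
  moreover have "integral\<^sup>L lborel f = of_real (sqrt pi) * F 0"
    unfolding f_def[abs_def] using integral_gaussian by (simp add: mult.commute)
  ultimately have "((\<lambda>t. integral\<^sup>L lborel (s t)) \<longlongrightarrow> of_real (sqrt pi) * F 0) at_top" by simp
  then show ?thesis
    by (rule Lim_transform_eventually)
       (use eventually_gt_at_top[of 0] in eventually_elim, simp only: scale)
qed

subsection \<open>The contour through the dominant saddle point\<close>

context dominant_saddle
begin

text \<open>On the curve the chart coordinate \<open>y\<close> satisfies
  \<open>y\<^sup>2 = \<tau>\<close> and lies in the sector of \<open>s\<close>, so it is real with
  the sign of \<open>s\<close>. Near the saddle point \<open>z \<tau> - zs\<close> is about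
  \<open>y / g zs\<close>, and division by \<open>v = \<i> / g zs\<close> turns it into about
  \<open>- \<i> * y\<close>: the curve leaves at a right angle to the segment.\<close>

lemma hill_curve_side:
  assumes chart: "saddle_chart H zs N e g \<psi>" and s: "s \<in> {1, -1}"
    and other: "\<psi> ` sector e (- s) \<inter> hill P h0 = {}"
    and z: "ascending_curve H zs {0..} z" "\<And>\<tau>. \<tau> > 0 \<Longrightarrow> z \<tau> \<in> hill P h0"
  shows "eventually (\<lambda>\<tau>. 0 < (- s) * Im ((z \<tau> - zs) / (\<i> / g zs))) (at_right 0)"
proof -
  note N = saddle_chartD[OF chart]
  define v where "v = \<i> / g zs"
  have gz: "g zs \<noteq> 0" using N(5)[OF N(2)] .
  have zlim: "(z \<longlongrightarrow> zs) (at_right 0)" by (rule ascending_curve_start[OF z(1)])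
  have "isCont g zs" using N(1,2,4) holomorphic_on_imp_continuous_on continuous_on_eq_continuous_at by blast
  then have "((\<lambda>\<tau>. Im (1 / (v * g (z \<tau>)))) \<longlongrightarrow> Im (1 / (v * g zs))) (at_right 0)"
    by (intro tendsto_intros isCont_tendsto_compose[OF _ zlim]) (use gz in \<open>auto simp: v_def\<close>)
  moreover have "Im (1 / (v * g zs)) = -1" using gz by (simp add: v_def)
  ultimately have "eventually (\<lambda>\<tau>. Im (1 / (v * g (z \<tau>))) < 0) (at_right 0)"
    by (intro order_tendstoD(2)) auto
  moreover have "eventually (\<lambda>\<tau>. z \<tau> \<in> N) (at_right 0)" using zlim N(1,2) by (rule topological_tendstoD)
  moreover have "eventually (\<lambda>\<tau>::real. 0 < \<tau>) (at_right 0)" by (rule eventually_at_right_less)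
  ultimately have "eventually (\<lambda>\<tau>. 0 < (- s) * Im ((z \<tau> - zs) / v)) (at_right 0)"
  proof eventually_elim
    case (elim \<tau>)
    define y where "y = (z \<tau> - zs) * g (z \<tau>)"
    have gne: "g (z \<tau>) \<noteq> 0" using N(5) elim by auto
    have "\<i> * y\<^sup>2 = \<i> * of_real \<tau>"
      using N(6)[of "z \<tau>"] ascending_curve_height[OF z(1), of \<tau>] elim by (simp add: y_def)
    then have sq: "y\<^sup>2 = of_real \<tau>" by simp
    have inv: "\<psi> y = z \<tau>" "y \<in> ball 0 e"
      using N(7) elim(2) by (auto simp: homeomorphism_def y_def)
    have "0 < Re (y\<^sup>2)" using sq elim by simp
    then obtain s' where s': "s' \<in> {1, -1 :: real}" "y \<in> sector e s'" using sectors inv(2) by metis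
    have "z \<tau> \<in> \<psi> ` sector e s'" using s'(2) inv(1) by force
    then have "s' \<noteq> - s" using other z(2)[of \<tau>] elim by blast
    then have "s' = s" using s s'(1) by auto
    then have ry: "s * Re y > 0" using s'(2) by (auto simp: sector_def)
    have "Im (y\<^sup>2) = 0" by (simp add: sq)
    then have "Re y = 0 \<or> Im y = 0" by (auto simp: power2_eq_square)
    then have "y = of_real (Re y)" using ry by (auto simp: complex_eq_iff)
    moreover have "(z \<tau> - zs) / v = y * (1 / (v * g (z \<tau>)))" using gne by (simp add: y_def)
    ultimately have "Im ((z \<tau> - zs) / v) = Re y * Im (1 / (v * g (z \<tau>)))"
      by (metis Im_complex_of_real Re_complex_of_real add.right_neutral mult_zero_left times_complex.sel(2))
    then have "(- s) * Im ((z \<tau> - zs) / v) = (s * Re y) * (- Im (1 / (v * g (z \<tau>))))" by simp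
    also have "\<dots> > 0" by (rule mult_pos_pos[OF ry]) (use elim(1) in simp)
    finally show ?case .
  qed
  then show ?thesis by (simp only: v_def)
qed

text \<open>The direction \<open>v\<close> is the imaginary axis of the saddle chart to first order,
  that is, the direction of steepest descent. With
  \<open>deriv (deriv H) zs = 2 * \<i> * (g zs)\<^sup>2\<close> and \<open>v * g zs = \<i>\<close>
  this gives the stated value of \<open>v\<^sup>2 * deriv (deriv H) zs\<close>.\<close>

lemma dominant_contour:
  obtains v \<epsilon> k \<gamma> where "v\<^sup>2 * deriv (deriv H) zs = - 2 * \<i>" "\<epsilon> > 0"
    "continuous_on {-\<epsilon>..\<epsilon>} k" "k 0 = -1" "\<And>x. x \<in> {-\<epsilon>..\<epsilon>} \<Longrightarrow> Re (k x) \<le> - 1 / 2"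
    "\<And>x. x \<in> {-\<epsilon>..\<epsilon>} \<Longrightarrow> zs + of_real x * v \<noteq> 0 \<and>
        H (zs + of_real x * v) = H zs + \<i> * of_real (x\<^sup>2) * k x"
    "valid_path \<gamma>" "pathstart \<gamma> = zs + of_real \<epsilon> * v" "pathfinish \<gamma> = zs - of_real \<epsilon> * v"
    "path_image \<gamma> \<subseteq> {z. z \<noteq> 0 \<and> Im (H z) < h0}"
    "winding_number (linepath (zs - of_real \<epsilon> * v) (zs + of_real \<epsilon> * v) +++ \<gamma>) 0 \<in> {1, -1}"
proof -
  have "zs \<in> - {0}" using zs by simp
  from saddle_chart_exists[OF holo open_punctured this zs(2,3)]
  obtain N e g \<psi> where N0: "N \<subseteq> - {0}" and chart: "saddle_chart H zs N e g \<psi>" by blast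
  note N = saddle_chartD[OF chart]
  obtain s where s: "s \<in> {1, -1}" "\<psi> ` sector e s \<subseteq> inner_hill h0" "\<psi> ` sector e (- s) \<subseteq> outer_hill h0"
    using pass_saddle_sectors[OF hills_disjoint zs(1) zs_in_closures chart N0] by blast
  define v where "v = \<i> / g zs"
  \<comment> \<open>The squared chart coordinate at \<open>zs + x * v\<close> is
    \<open>x\<^sup>2 * k x\<close>, and \<open>v * g zs = \<i>\<close> makes
    \<open>k 0 = -1\<close>.\<close>
  define k where "k x = (v * g (zs + of_real x * v))\<^sup>2" for x :: real
  have gz: "g zs \<noteq> 0" using N(5)[OF N(2)] .
  then have v0: "v \<noteq> 0" by (simp add: v_def)
  have contg: "continuous_on N g" using N(4) holomorphic_on_imp_continuous_on by blast
  have line: "isCont (\<lambda>x. zs + complex_of_real x * v) 0" by (intro continuous_intros)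
  have "isCont g zs" using contg N(1,2) continuous_on_eq_continuous_at by blast
  then have "isCont g (zs + complex_of_real 0 * v)" by simp
  then have "isCont k 0" unfolding k_def by (intro continuous_intros isCont_o2[OF line])
  then have "(k \<longlongrightarrow> k 0) (nhds 0)"
    using tendsto_at_iff_tendsto_nhds[of k 0] by (simp add: isCont_def)
  then have "eventually (\<lambda>x. dist (k x) (k 0) < 1 / 2) (nhds 0)" by (rule tendstoD) simp
  moreover have k0: "k 0 = -1" using gz by (simp add: k_def v_def)
  ultimately have "eventually (\<lambda>x. dist (k x) (-1) < 1 / 2) (nhds 0)" by simp
  moreover have "eventually (\<lambda>x. zs + of_real x * v \<in> N) (nhds 0)"
  proof (rule topological_tendstoD[OF _ N(1)])
    show "((\<lambda>x. zs + complex_of_real x * v) \<longlongrightarrow> zs + of_real 0 * v) (nhds 0)"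
      using line tendsto_at_iff_tendsto_nhds[of "\<lambda>x. zs + complex_of_real x * v" 0] by (simp add: isCont_def)
  qed (use N(2) in auto)
  ultimately have "eventually (\<lambda>x. dist (k x) (-1) < 1 / 2 \<and> zs + of_real x * v \<in> N) (nhds 0)"
    by (rule eventually_conj)
  then obtain d where d: "d > 0" "\<And>x. dist x 0 < d \<Longrightarrow> dist (k x) (-1) < 1 / 2 \<and> zs + of_real x * v \<in> N"
    unfolding eventually_nhds_metric by auto
  define \<epsilon> where "\<epsilon> = d / 2"
  have \<epsilon>: "\<epsilon> > 0" using d by (simp add: \<epsilon>_def)
  have seg: "dist (k x) (-1) < 1 / 2" "zs + of_real x * v \<in> N" if "x \<in> {-\<epsilon>..\<epsilon>}" for x
    using d that by (auto simp: \<epsilon>_def)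
  have kneg: "Re (k x) \<le> - 1 / 2" if "x \<in> {-\<epsilon>..\<epsilon>}" for x
    using seg(1)[OF that] abs_Re_le_cmod[of "k x - (-1)"] by (simp add: dist_norm)
  have contk: "continuous_on {-\<epsilon>..\<epsilon>} k" unfolding k_def[abs_def]
    by (intro continuous_intros continuous_on_compose2[OF contg]) (use seg(2) in auto)
  have Hseg: "H (zs + of_real x * v) = H zs + \<i> * of_real (x\<^sup>2) * k x" if "x \<in> {-\<epsilon>..\<epsilon>}" for x
    using N(6)[OF seg(2)[OF that]] by (simp add: k_def power_mult_distrib)
  have Hlow: "Im (H (zs + of_real x * v)) \<le> h0 - x\<^sup>2 / 2" if "x \<in> {-\<epsilon>..\<epsilon>}" for x
  proof -
    have "Im (H (zs + of_real x * v)) = h0 + x\<^sup>2 * Re (k x)"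
      using Hseg[OF that] by (simp flip: of_real_power)
    also have "\<dots> \<le> h0 + x\<^sup>2 * (- 1 / 2)" using kneg[OF that] by (intro add_left_mono mult_left_mono) auto
    finally show ?thesis by simp
  qed
  define p q where "p = zs + of_real \<epsilon> * v" and "q = zs - of_real \<epsilon> * v"
  have pq: "p \<in> N" "q \<in> N" using seg(2)[of \<epsilon>] seg(2)[of "- \<epsilon>"] \<epsilon> by (auto simp: p_def q_def)
  have "Im (H p) < h0" "Im (H q) < h0"
  proof -
    have "0 < \<epsilon>\<^sup>2 / 2" using \<epsilon> by simp
    moreover have "Im (H p) \<le> h0 - \<epsilon>\<^sup>2 / 2" "Im (H q) \<le> h0 - \<epsilon>\<^sup>2 / 2"
      using Hlow[of \<epsilon>] Hlow[of "- \<epsilon>"] \<epsilon> by (auto simp: p_def q_def)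
    ultimately show "Im (H p) < h0" "Im (H q) < h0" by linarith+
  qed
  define U where "U = {z. z \<noteq> 0 \<and> Im (H z) < h0}"
  have pqU: "connected_component U p q"
    unfolding U_def by (rule below_connected[OF chart N0 s pq]) fact+
  have "open U" using open_preimage[OF open_halfspace_Im_lt[of h0]] by (simp add: U_def)
  \<comment> \<open>A polynomial path is smooth, as contour integration requires.\<close>
  then obtain \<gamma> where \<gamma>: "polynomial_function \<gamma>" "path_image \<gamma> \<subseteq> connected_component_set U p"
      "pathstart \<gamma> = p" "pathfinish \<gamma> = q"
    using connected_open_polynomial_connected[of "connected_component_set U p" p q] pqU
      open_connected_component connected_component_in by (metis connected_component_refl connected_connected_component mem_Collect_eq)
  have vp: "valid_path \<gamma>" using \<gamma>(1) valid_path_polynomial_function by blast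
  have \<gamma>U: "path_image \<gamma> \<subseteq> U" using \<gamma>(2) connected_component_subset by blast
  define L where "L = linepath q p"
  define \<Gamma> where "\<Gamma> = L +++ \<gamma>"
  have \<Gamma>: "path \<Gamma>" "pathfinish \<Gamma> = pathstart \<Gamma>"
    using vp \<gamma>(3,4) by (auto simp: \<Gamma>_def L_def valid_path_imp_path)
  have Limg: "z \<noteq> 0 \<and> Im (H z) \<le> h0" if z: "z \<in> path_image L" for z
  proof -
    obtain u where u: "0 \<le> u" "u \<le> 1" "z = (1 - u) *\<^sub>R q + u *\<^sub>R p" using z by (auto simp: L_def closed_segment_def)
    define x where "x = (2 * u - 1) * \<epsilon>"
    have zx: "z = zs + of_real x * v"
      by (simp add: u(3) x_def p_def q_def scaleR_conv_of_real algebra_simps)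
    have "0 \<le> u * \<epsilon>" "u * \<epsilon> \<le> 1 * \<epsilon>" using u \<epsilon> by (auto intro: mult_right_mono)
    then have "x \<in> {-\<epsilon>..\<epsilon>}" by (auto simp: x_def algebra_simps)
    then have "z \<in> N" "Im (H z) \<le> h0 - x\<^sup>2 / 2" unfolding zx using Hlow seg(2) by blast+
    moreover have "0 \<le> x\<^sup>2 / 2" by simp
    ultimately show ?thesis using N0 by (intro conjI) (blast, linarith)
  qed
  have \<Gamma>img: "path_image \<Gamma> = path_image L \<union> path_image \<gamma>"
    unfolding \<Gamma>_def using \<gamma>(3) by (intro path_image_join) (simp add: L_def)
  have off: "z \<notin> path_image \<Gamma>" if "z \<in> superlevel h0" for z
    using that Limg[of z] \<gamma>U by (auto simp: \<Gamma>img U_def superlevel_def)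
  have zs\<gamma>: "zs \<notin> path_image \<gamma>" using \<gamma>U by (auto simp: U_def)
  \<comment> \<open>The winding number of the loop is constant along the curve. As
    \<open>\<tau>\<close> tends to 0 it splits into the half turn of the segment and the winding
    number of \<open>\<gamma>\<close>, which is continuous at \<open>zs\<close> because
    \<open>\<gamma>\<close> avoids it.\<close>
  have crossing: "winding_number \<Gamma> (z T) = of_real (- s' / 2) + winding_number \<gamma> zs"
    if s': "s' \<in> {1, -1}" and other: "\<psi> ` sector e (- s') \<inter> hill P h0 = {}"
      and z: "ascending_curve H zs {0..} z" "\<And>\<tau>. \<tau> > 0 \<Longrightarrow> z \<tau> \<in> hill P h0" and T: "T > 0"
    for s' P z T
  proof -
    have offz: "z \<tau> \<notin> path_image \<Gamma>" if "\<tau> > 0" for \<tau> using off z(2)[OF that] hill_subset by blast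
    have const: "winding_number \<Gamma> (z \<tau>) = winding_number \<Gamma> (z T)" if "\<tau> > 0" for \<tau>
      by (rule winding_number_eq[OF \<Gamma>, of _ "z ` {0<..}"])
         (use that T offz connected_ascending_curve[OF z(1)] in auto)
    have zlim: "(z \<longlongrightarrow> zs) (at_right 0)" by (rule ascending_curve_start[OF z(1)])
    have "((\<lambda>\<tau>. winding_number L (z \<tau>)) \<longlongrightarrow> of_real (- s' / 2)) (at_right 0)"
      unfolding L_def p_def q_def
    proof (rule winding_number_segment_limit[OF v0 \<epsilon> _ zlim])
      show "eventually (\<lambda>\<tau>. 0 < - s' * Im ((z \<tau> - zs) / v)) (at_right 0)"
        unfolding v_def by (rule hill_curve_side[OF chart s' other z])
    qed (use s' in auto)
    moreover have "((\<lambda>\<tau>. winding_number \<gamma> (z \<tau>)) \<longlongrightarrow> winding_number \<gamma> zs) (at_right 0)"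
      by (rule isCont_tendsto_compose[OF continuous_at_winding_number[OF valid_path_imp_path[OF vp] zs\<gamma>] zlim])
    ultimately have sum_lim: "((\<lambda>\<tau>. winding_number L (z \<tau>) + winding_number \<gamma> (z \<tau>)) \<longlongrightarrow>
        of_real (- s' / 2) + winding_number \<gamma> zs) (at_right 0)"
      by (rule tendsto_add)
    have ev: "eventually (\<lambda>\<tau>. winding_number L (z \<tau>) + winding_number \<gamma> (z \<tau>) = winding_number \<Gamma> (z T)) (at_right 0)"
      using eventually_at_right_less[of 0]
    proof eventually_elim
      case (elim \<tau>)
      have "winding_number \<Gamma> (z \<tau>) = winding_number L (z \<tau>) + winding_number \<gamma> (z \<tau>)"
        unfolding \<Gamma>_def using offz[OF elim] vp \<gamma>(3)
        by (intro winding_number_join) (auto simp: \<Gamma>img L_def valid_path_imp_path)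
      then show ?case using const[OF elim] by simp
    qed
    have "((\<lambda>\<tau>. winding_number \<Gamma> (z T)) \<longlongrightarrow> of_real (- s' / 2) + winding_number \<gamma> zs) (at_right (0::real))"
      using sum_lim unfolding tendsto_cong[OF ev] .
    then show ?thesis by (intro tendsto_unique[OF trivial_limit_at_right_real tendsto_const])
  qed
  obtain zi zo where zi: "ascending_curve H zs {0..} zi" "\<And>\<tau>. \<tau> > 0 \<Longrightarrow> zi \<tau> \<in> inner_hill h0"
    and zo: "ascending_curve H zs {0..} zo" "\<And>\<tau>. \<tau> > 0 \<Longrightarrow> zo \<tau> \<in> outer_hill h0"
    using relevant_hill_curves[OF relevant_zs] by metis
  have "0 \<in> - path_image \<Gamma>" using Limg \<gamma>U by (auto simp: \<Gamma>img U_def)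
  moreover have "open (- path_image \<Gamma>)" using \<Gamma>(1) closed_path_image by blast
  ultimately obtain r where r: "r > 0" "ball 0 r \<subseteq> - path_image \<Gamma>" using openE by blast
  obtain \<tau>i where \<tau>i: "\<tau>i > 0" "norm (zi \<tau>i) < r"
    using inner_curve_tends_to_0[OF hills_disjoint zi r(1)] by metis
  have "winding_number \<Gamma> 0 = winding_number \<Gamma> (zi \<tau>i)"
    by (rule winding_number_eq[OF \<Gamma>, of _ "ball 0 r"]) (use r \<tau>i in auto)
  also have "\<dots> = of_real (- s / 2) + winding_number \<gamma> zs"
    by (rule crossing[OF s(1) _ zi \<tau>i(1)]) (use s(3) hills_disjoint in blast)
  finally have w0: "winding_number \<Gamma> 0 = of_real (- s / 2) + winding_number \<gamma> zs" .
  \<comment> \<open>The outer curve reaches the region where the winding number is 0, which forces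
    the contribution of \<open>\<gamma>\<close> to be \<open>- s / 2\<close>. Around 0 the two
    halves then add up to \<open>- s\<close>.\<close>
  obtain B where B: "\<And>z. B \<le> norm z \<Longrightarrow> winding_number \<Gamma> z = 0"
    using winding_number_zero_at_infinity[OF \<Gamma>] by blast
  obtain \<tau>o where \<tau>o: "\<tau>o > 0" "norm (zo \<tau>o) > B"
    using outer_curve_tends_to_infinity[OF hills_disjoint zo] by metis
  have "0 = winding_number \<Gamma> (zo \<tau>o)" using B \<tau>o by simp
  also have "\<dots> = of_real (- (- s) / 2) + winding_number \<gamma> zs"
    by (rule crossing[OF _ _ zo \<tau>o(1)]) (use s hills_disjoint in auto)
  finally have "winding_number \<gamma> zs = - of_real (s / 2)" by (simp add: eq_neg_iff_add_eq_0 add.commute)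
  then have "winding_number \<Gamma> 0 \<in> {1, -1}" using w0 s(1) by auto
  then show ?thesis
    using that[of v \<epsilon> k \<gamma>] \<epsilon> contk k0 kneg Hseg seg(2) N0 vp \<gamma>(3,4) \<gamma>U gz N(9)
    by (force simp: U_def p_def q_def \<Gamma>_def L_def v_def power_divide)
qed

end

subsection \<open>Asymptotics\<close>

text \<open>A positive factor leaves the argument unchanged, so the principal root does not jump;
  this is what makes the sign of the root independent of \<open>t\<close>.\<close>

lemma csqrt_mult_of_real:
  assumes "0 < t" "A \<noteq> 0"
  shows "csqrt (A * of_real t) = of_real (sqrt t) * csqrt A"
proof -
  have "csqrt (A * of_real t) = exp ((of_real (ln t) + Ln A) / 2)"
    using assms Ln_times_of_real[OF assms] by (simp add: csqrt_exp_Ln mult.commute Ln_of_real[OF assms(1)])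
  also have "\<dots> = exp (of_real (ln t / 2)) * csqrt A"
    using assms by (simp add: csqrt_exp_Ln add_divide_distrib exp_add)
  also have "exp (complex_of_real (ln t / 2)) = of_real (sqrt t)"
  proof -
    have "exp (ln t / 2) = sqrt t"
      using assms by (simp add: powr_half_sqrt[symmetric] powr_def)
    then show ?thesis by (simp only: exp_of_real)
  qed
  finally show ?thesis .
qed

lemma integral_0_1_eq_symmetric_interval:
  fixes f :: "real \<Rightarrow> complex"
  assumes "\<epsilon> > 0" "continuous_on {-\<epsilon>..\<epsilon>} f"
  shows "integral {0..1} (\<lambda>u. f (2 * \<epsilon> * u - \<epsilon>)) = integral {-\<epsilon>..\<epsilon>} f / (2 * of_real \<epsilon>)"
proof -
  have "(f has_integral integral {-\<epsilon>..\<epsilon>} f) (cbox (-\<epsilon>) \<epsilon>)"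
    using assms by (simp add: integrable_continuous_interval has_integral_integral[symmetric])
  from has_integral_affinity[OF this, of "2 * \<epsilon>" "- \<epsilon>"]
  have "((\<lambda>x. f (2 * \<epsilon> * x - \<epsilon>)) has_integral (1 / (2 * \<epsilon>)) *\<^sub>R integral {-\<epsilon>..\<epsilon>} f)
      ((\<lambda>x. (1 / (2 * \<epsilon>)) * x + 1 / 2) ` {-\<epsilon>..\<epsilon>})"
    using assms(1) by simp
  also have "(\<lambda>x. (1 / (2 * \<epsilon>)) * x + 1 / 2) ` {-\<epsilon>..\<epsilon>} = {0..1}"
    using assms(1) by (subst image_affinity_atLeastAtMost) (auto simp: field_simps)
  finally show ?thesis
    using assms(1) by (auto dest!: integral_unique simp: scaleR_conv_of_real)
qed

context dominant_saddle
begin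

text \<open>The path is compact, so its greatest height is strictly below \<open>h0\<close>; a level
  \<open>m\<close> between the two leaves an exponential gain that beats
  \<open>sqrt t\<close>.\<close>

lemma exponentially_small_below:
  assumes vp: "valid_path \<gamma>" and img: "path_image \<gamma> \<subseteq> {z. z \<noteq> 0 \<and> Im (H z) < h0}"
    and holA: "A holomorphic_on - {0}"
  shows "((\<lambda>t. of_real (sqrt t) * exp (\<i> * H zs * of_real t) *
     contour_integral \<gamma> (\<lambda>z. A z * exp (- \<i> * H z * of_real t))) \<longlongrightarrow> 0) at_top"
proof -
  have comp: "compact (path_image \<gamma>)" "path_image \<gamma> \<noteq> {}"
    using vp by (auto simp: compact_path_image valid_path_imp_path)
  have img0: "path_image \<gamma> \<subseteq> - {0}" using img by auto
  have contA: "continuous_on (- {0}) A" using holA holomorphic_on_imp_continuous_on by blast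
  have "continuous_on (path_image \<gamma>) (\<lambda>z. Im (H z))" "continuous_on (path_image \<gamma>) (\<lambda>z. norm (A z))"
    by (intro continuous_intros continuous_on_subset[OF continuous_H img0] continuous_on_subset[OF contA img0])+
  then obtain z0 z1 where z0: "z0 \<in> path_image \<gamma>" "\<And>z. z \<in> path_image \<gamma> \<Longrightarrow> Im (H z) \<le> Im (H z0)"
    and z1: "z1 \<in> path_image \<gamma>" "\<And>z. z \<in> path_image \<gamma> \<Longrightarrow> norm (A z) \<le> norm (A z1)"
    using continuous_attains_sup[OF comp] by metis
  define a where "a = norm (A z1) + 1"
  define m where "m = (Im (H z0) + h0) / 2"
  have m: "Im (H z0) < m" "m < h0" using z0(1) img by (auto simp: m_def)
  define S where "S = {z. z \<noteq> 0 \<and> H z \<in> {y. Im y < m}} \<inter> ((- {0}) \<inter> A -` ball 0 a)"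
  have S: "open S" unfolding S_def
    by (intro open_Int open_preimage open_halfspace_Im_lt continuous_open_preimage contA open_punctured open_ball)
  have imgS: "path_image \<gamma> \<subseteq> S"
  proof
    fix z assume z: "z \<in> path_image \<gamma>"
    then show "z \<in> S" using img z0(2)[OF z] z1(2)[OF z] m by (auto simp: S_def a_def)
  qed
  have "a \<ge> 0" by (simp add: a_def)
  \<comment> \<open>\<open>L\<close> depends only on the path and its neighbourhood
    \<open>S\<close>, so one constant serves the integrands for all \<open>t\<close>.\<close>
  obtain L where L: "L > 0" "\<And>f B. f holomorphic_on S \<Longrightarrow> (\<forall>z\<in>S. norm (f z) \<le> B) \<Longrightarrow> norm (contour_integral \<gamma> f) \<le> L * B"
    using contour_integral_bound_exists[OF S vp imgS] by metis
  have bound: "norm (contour_integral \<gamma> (\<lambda>z. A z * exp (- \<i> * H z * of_real t))) \<le> L * (a * exp (m * t))"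
    if t: "t > 0" for t
  proof (rule L(2))
    show "(\<lambda>z. A z * exp (- \<i> * H z * of_real t)) holomorphic_on S"
      by (intro holomorphic_intros holomorphic_on_subset[OF holA] holomorphic_on_subset[OF holo])
         (auto simp: S_def)
    show "\<forall>z\<in>S. norm (A z * exp (- \<i> * H z * of_real t)) \<le> a * exp (m * t)"
    proof
      fix z assume z: "z \<in> S"
      have "norm (A z * exp (- \<i> * H z * of_real t)) = norm (A z) * exp (Im (H z) * t)"
        by (simp add: norm_mult)
      also have "\<dots> \<le> a * exp (m * t)"
        using z t \<open>a \<ge> 0\<close> by (intro mult_mono) (auto simp: S_def)
      finally show "norm (A z * exp (- \<i> * H z * of_real t)) \<le> a * exp (m * t)" .
    qed
  qed
  have "((\<lambda>t. L * a * (sqrt t * exp (- (h0 - m) * t))) \<longlongrightarrow> L * a * 0) at_top"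
  proof (intro tendsto_mult tendsto_const)
    have "h0 - m > 0" using m by simp
    then show "((\<lambda>t. sqrt t * exp (- (h0 - m) * t)) \<longlongrightarrow> 0) at_top"
      by real_asymp
  qed
  then have "((\<lambda>t. L * a * (sqrt t * exp (- (h0 - m) * t))) \<longlongrightarrow> 0) at_top" by simp
  then show ?thesis
  proof (rule Lim_null_comparison[rotated])
    show "eventually (\<lambda>t. norm (of_real (sqrt t) * exp (\<i> * H zs * of_real t) *
        contour_integral \<gamma> (\<lambda>z. A z * exp (- \<i> * H z * of_real t))) \<le> L * a * (sqrt t * exp (- (h0 - m) * t))) at_top"
      using eventually_gt_at_top[of 0]
    proof eventually_elim
      case (elim t)
      have "norm (of_real (sqrt t) * exp (\<i> * H zs * of_real t) *
          contour_integral \<gamma> (\<lambda>z. A z * exp (- \<i> * H z * of_real t)))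
        = (sqrt t * exp (- (h0 * t))) * norm (contour_integral \<gamma> (\<lambda>z. A z * exp (- \<i> * H z * of_real t)))"
        using elim by (simp add: norm_mult)
      also have "\<dots> \<le> (sqrt t * exp (- (h0 * t))) * (L * (a * exp (m * t)))"
        using elim by (intro mult_left_mono bound) auto
      also have "\<dots> = L * a * (sqrt t * (exp (- (h0 * t)) * exp (m * t)))" by simp
      also have "exp (- (h0 * t)) * exp (m * t) = exp (- (h0 - m) * t)"
        by (simp add: algebra_simps flip: exp_add)
      finally show ?case .
    qed
  qed
qed

lemma segment_asymptotics:
  assumes \<epsilon>: "\<epsilon> > 0" and k: "continuous_on {-\<epsilon>..\<epsilon>} k" "k 0 = -1"
      "\<And>x. x \<in> {-\<epsilon>..\<epsilon>} \<Longrightarrow> Re (k x) \<le> - 1 / 2"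
    and seg: "\<And>x. x \<in> {-\<epsilon>..\<epsilon>} \<Longrightarrow> zs + of_real x * v \<noteq> 0 \<and>
        H (zs + of_real x * v) = H zs + \<i> * of_real (x\<^sup>2) * k x"
    and holA: "A holomorphic_on - {0}"
  shows "((\<lambda>t. of_real (sqrt t) * exp (\<i> * H zs * of_real t) *
     contour_integral (linepath (zs - of_real \<epsilon> * v) (zs + of_real \<epsilon> * v)) (\<lambda>z. A z * exp (- \<i> * H z * of_real t)))
       \<longlongrightarrow> v * of_real (sqrt pi) * A zs) at_top"
proof -
  let ?L = "linepath (zs - of_real \<epsilon> * v) (zs + of_real \<epsilon> * v)"
  define F where "F x = A (zs + of_real x * v)" for x :: real
  have contF: "continuous_on {-\<epsilon>..\<epsilon>} F" unfolding F_def[abs_def]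
    by (intro continuous_on_compose2[OF holomorphic_on_imp_continuous_on[OF holA]] continuous_intros)
       (use seg in auto)
  have eq: "of_real (sqrt t) * exp (\<i> * H zs * of_real t) *
      contour_integral ?L (\<lambda>z. A z * exp (- \<i> * H z * of_real t)) =
      v * (of_real (sqrt t) * integral {-\<epsilon>..\<epsilon>} (\<lambda>x. F x * exp (of_real (t * x\<^sup>2) * k x)))" for t
  proof -
    define f where "f x = F x * exp (of_real (t * x\<^sup>2) * k x)" for x
    have contf: "continuous_on {-\<epsilon>..\<epsilon>} f" unfolding f_def
      by (intro continuous_intros contF k)
    have "zs + of_real \<epsilon> * v - (zs - of_real \<epsilon> * v) = 2 * of_real \<epsilon> * v" by simp
    then have "contour_integral ?L (\<lambda>z. A z * exp (- \<i> * H z * of_real t)) =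
        integral {0..1} (\<lambda>u. A (?L u) * exp (- \<i> * H (?L u) * of_real t) * (2 * of_real \<epsilon> * v))"
      by (simp only: contour_integral_integral vector_derivative_linepath_at)
    also have "\<dots> = integral {0..1} (\<lambda>u. (2 * of_real \<epsilon> * v * exp (- \<i> * H zs * of_real t)) * f (2 * \<epsilon> * u - \<epsilon>))"
    proof (rule integral_cong)
      fix u :: real assume u: "u \<in> {0..1}"
      define x where "x = 2 * \<epsilon> * u - \<epsilon>"
      have "0 \<le> u * \<epsilon>" "u * \<epsilon> \<le> 1 * \<epsilon>" using u \<epsilon> by (auto intro: mult_right_mono)
      then have x: "x \<in> {-\<epsilon>..\<epsilon>}" by (auto simp: x_def algebra_simps)
      have Lx: "?L u = zs + of_real x * v"
        by (simp add: linepath_def x_def scaleR_conv_of_real algebra_simps)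
      \<comment> \<open>The product of \<open>- \<i>\<close> with the \<open>\<i>\<close> before the
        quadratic term is 1, which leaves the exponent of Laplace's method.\<close>
      have "- \<i> * H (?L u) * of_real t = - \<i> * H zs * of_real t + of_real (t * x\<^sup>2) * k x"
        unfolding Lx using seg[OF x] by (simp add: algebra_simps)
      then have ex: "exp (- \<i> * H (?L u) * of_real t) = exp (- \<i> * H zs * of_real t) * exp (of_real (t * x\<^sup>2) * k x)"
        by (simp only: exp_add)
      have AL: "A (?L u) = F x" by (simp only: F_def Lx)
      show "A (?L u) * exp (- \<i> * H (?L u) * of_real t) * (2 * of_real \<epsilon> * v) =
          (2 * of_real \<epsilon> * v * exp (- \<i> * H zs * of_real t)) * f (2 * \<epsilon> * u - \<epsilon>)"
        unfolding f_def x_def[symmetric] ex AL by (simp only: mult_ac)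
    qed
    also have "\<dots> = (2 * of_real \<epsilon> * v * exp (- \<i> * H zs * of_real t)) * (integral {-\<epsilon>..\<epsilon>} f / (2 * of_real \<epsilon>))"
      by (simp only: integral_mult_right integral_0_1_eq_symmetric_interval[OF \<epsilon> contf])
    also have "\<dots> = v * exp (- \<i> * H zs * of_real t) * integral {-\<epsilon>..\<epsilon>} f" using \<epsilon> by simp
    finally have *: "contour_integral ?L (\<lambda>z. A z * exp (- \<i> * H z * of_real t)) =
        v * exp (- \<i> * H zs * of_real t) * integral {-\<epsilon>..\<epsilon>} f" .
    have "exp (\<i> * H zs * of_real t) * exp (- \<i> * H zs * of_real t) = 1"
      by (simp flip: exp_add)
    then show ?thesis unfolding * f_def by (simp add: algebra_simps)
  qed
  have "((\<lambda>t. v * (of_real (sqrt t) * integral {-\<epsilon>..\<epsilon>} (\<lambda>x. F x * exp (of_real (t * x\<^sup>2) * k x))))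
      \<longlongrightarrow> v * (of_real (sqrt pi) * F 0)) at_top"
    by (intro tendsto_mult tendsto_const laplace_asymptotics \<epsilon> contF k)
  then show ?thesis unfolding eq by (simp add: F_def mult.assoc)
qed

text \<open>The integrand is holomorphic off 0, so its integral over the loop is that over the unit
  circle times the winding number \<open>\<eta>\<close>. As \<open>\<eta>\<close> is its own
  inverse, it can be moved to the other side and absorbed into \<open>v\<close>, of which only the
  square is prescribed.\<close>

lemma green_fun_limit:
  obtains v where "v\<^sup>2 * deriv (deriv H) zs = - 2 * \<i>"
    "\<And>x x'. ((\<lambda>t. of_real (sqrt t) * exp (\<i> * H zs * of_real t) * green_fun H x x' t) \<longlongrightarrow>
       v * of_real (sqrt pi) * (1 / (2 * of_real pi * \<i> * zs) * zs powi (x - x'))) at_top"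
proof -
  obtain v \<epsilon> k \<gamma> where v: "v\<^sup>2 * deriv (deriv H) zs = - 2 * \<i>" and \<epsilon>: "\<epsilon> > 0"
    and k: "continuous_on {-\<epsilon>..\<epsilon>} k" "k 0 = -1" "\<And>x. x \<in> {-\<epsilon>..\<epsilon>} \<Longrightarrow> Re (k x) \<le> - 1 / 2"
    and seg: "\<And>x. x \<in> {-\<epsilon>..\<epsilon>} \<Longrightarrow> zs + of_real x * v \<noteq> 0 \<and>
        H (zs + of_real x * v) = H zs + \<i> * of_real (x\<^sup>2) * k x"
    and \<gamma>: "valid_path \<gamma>" "pathstart \<gamma> = zs + of_real \<epsilon> * v" "pathfinish \<gamma> = zs - of_real \<epsilon> * v"
    "path_image \<gamma> \<subseteq> {z. z \<noteq> 0 \<and> Im (H z) < h0}"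
    and wn: "winding_number (linepath (zs - of_real \<epsilon> * v) (zs + of_real \<epsilon> * v) +++ \<gamma>) 0 \<in> {1, -1}"
    by (rule dominant_contour) blast
  define L where "L = linepath (zs - of_real \<epsilon> * v) (zs + of_real \<epsilon> * v)"
  define \<eta> where "\<eta> = winding_number (L +++ \<gamma>) 0"
  have \<eta>: "\<eta> \<in> {1, -1}" using wn by (simp add: \<eta>_def L_def)
  have "((\<lambda>t. of_real (sqrt t) * exp (\<i> * H zs * of_real t) * green_fun H x x' t) \<longlongrightarrow>
       (\<eta> * v) * of_real (sqrt pi) * (1 / (2 * of_real pi * \<i> * zs) * zs powi (x - x'))) at_top" for x x'
  proof -
    define A where "A z = 1 / (2 * of_real pi * \<i> * z) * z powi (x - x')" for z :: complex
    have holA: "A holomorphic_on - {0}"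
      unfolding A_def by (intro holomorphic_intros) auto
    define f where "f t z = A z * exp (- \<i> * H z * of_real t)" for t :: real and z
    have holf: "f t holomorphic_on - {0}" for t
      unfolding f_def by (intro holomorphic_intros holA holo)
    have Limg: "path_image L \<subseteq> - {0}"
    proof
      fix z assume "z \<in> path_image L"
      then obtain u where u: "0 \<le> u" "u \<le> 1" "z = (1 - u) *\<^sub>R (zs - of_real \<epsilon> * v) + u *\<^sub>R (zs + of_real \<epsilon> * v)"
        by (auto simp: L_def closed_segment_def)
      define y where "y = (2 * u - 1) * \<epsilon>"
      have zy: "z = zs + of_real y * v"
        by (simp add: u(3) y_def scaleR_conv_of_real algebra_simps)
      have "0 \<le> u * \<epsilon>" "u * \<epsilon> \<le> 1 * \<epsilon>" using u \<epsilon> by (auto intro: mult_right_mono)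
      then have "y \<in> {-\<epsilon>..\<epsilon>}" by (auto simp: y_def algebra_simps)
      then show "z \<in> - {0}" using seg zy by simp
    qed
    have \<gamma>img: "path_image \<gamma> \<subseteq> - {0}" using \<gamma>(4) by auto
    have vL: "valid_path L" by (simp add: L_def)
    have joinpt: "pathfinish L = pathstart \<gamma>" using \<gamma>(2) by (simp add: L_def)
    have residue: "contour_integral p (f t) = 2 * of_real pi * \<i> * (winding_number p 0 * residue (f t) 0)"
      if "valid_path p" "pathfinish p = pathstart p" "path_image p \<subseteq> - {0}" for p t
    proof -
      have "f t holomorphic_on UNIV - {0}" using holf[of t] by (simp add: Compl_eq_Diff_UNIV)
      from Residue_theorem[OF open_UNIV connected_UNIV _ this that(1,2)] show ?thesis
        using that(3) by (simp add: Compl_eq_Diff_UNIV)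
    qed
    have green: "green_fun H x x' t = \<eta> * (contour_integral L (f t) + contour_integral \<gamma> (f t))" for t
    proof -
      have "green_fun H x x' t = contour_integral (circlepath 0 1) (f t)"
        by (simp add: green_fun_def f_def[abs_def] A_def)
      also have "\<dots> = 2 * of_real pi * \<i> * residue (f t) 0"
        by (subst residue) (auto simp: winding_number_circlepath_centre)
      also have "\<dots> = \<eta> * (2 * of_real pi * \<i> * (\<eta> * residue (f t) 0))" using \<eta> by auto
      also have "2 * of_real pi * \<i> * (\<eta> * residue (f t) 0) = contour_integral (L +++ \<gamma>) (f t)"
        unfolding \<eta>_def using vL \<gamma>(1,3) joinpt Limg \<gamma>img
        by (subst residue) (auto intro!: valid_path_join simp: path_image_join L_def)
      also have "\<dots> = contour_integral L (f t) + contour_integral \<gamma> (f t)"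
        by (intro contour_integral_join contour_integrable_holomorphic_simple[OF holf] vL \<gamma>(1) joinpt Limg \<gamma>img open_punctured)
      finally show ?thesis .
    qed
    define E where "E t = of_real (sqrt t) * exp (\<i> * H zs * of_real t)" for t
    have "((\<lambda>t. E t * contour_integral L (f t)) \<longlongrightarrow> v * of_real (sqrt pi) * A zs) at_top"
      unfolding E_def f_def[abs_def] L_def by (rule segment_asymptotics[OF \<epsilon> k seg holA])
    moreover have "((\<lambda>t. E t * contour_integral \<gamma> (f t)) \<longlongrightarrow> 0) at_top"
      unfolding E_def f_def[abs_def] by (rule exponentially_small_below[OF \<gamma>(1,4) holA])
    ultimately have "((\<lambda>t. E t * contour_integral L (f t) + E t * contour_integral \<gamma> (f t)) \<longlongrightarrow>
        v * of_real (sqrt pi) * A zs + 0) at_top"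
      by (rule tendsto_add)
    then have "((\<lambda>t. \<eta> * (E t * contour_integral L (f t) + E t * contour_integral \<gamma> (f t))) \<longlongrightarrow>
        \<eta> * (v * of_real (sqrt pi) * A zs + 0)) at_top"
      by (rule tendsto_mult_left)
    then show ?thesis
      by (simp add: green E_def A_def algebra_simps)
  qed
  moreover have "(\<eta> * v)\<^sup>2 * deriv (deriv H) zs = - 2 * \<i>" using \<eta> v by auto
  ultimately show ?thesis using that by blast
qed

theorem green_fun_asymptotics:
  "\<exists>\<sigma>\<in>{1, -1 :: complex}. \<forall>x x' :: int.
     (\<lambda>t :: real. green_fun H x x' t) \<sim>[at_top]
     (\<lambda>t. exp (- \<i> * H zs * of_real t) /
        (\<sigma> * csqrt (2 * of_real pi * \<i> ^ 3 * zs ^ 2 * deriv (deriv H) zs * of_real t)) *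
        zs powi (x - x'))"
proof -
  obtain v where v: "v\<^sup>2 * deriv (deriv H) zs = - 2 * \<i>"
    and lim: "\<And>x x'. ((\<lambda>t. of_real (sqrt t) * exp (\<i> * H zs * of_real t) * green_fun H x x' t) \<longlongrightarrow>
       v * of_real (sqrt pi) * (1 / (2 * of_real pi * \<i> * zs) * zs powi (x - x'))) at_top"
    using green_fun_limit by blast
  define A where "A = 2 * of_real pi * \<i> ^ 3 * zs ^ 2 * deriv (deriv H) zs"
  have A0: "A \<noteq> 0" using zs by (simp add: A_def)
  \<comment> \<open>The limit constant at \<open>x = x'\<close> multiplied by the principal root.
    The value of \<open>v\<^sup>2 * deriv (deriv H) zs\<close> makes its square 1, so the constant
    is also \<open>1 / (\<sigma> * csqrt A)\<close>.\<close>
  define \<sigma> where "\<sigma> = v * of_real (sqrt pi) * (1 / (2 * of_real pi * \<i> * zs)) * csqrt A"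
  have "\<sigma>\<^sup>2 = v\<^sup>2 * of_real ((sqrt pi)\<^sup>2) * (1 / (2 * of_real pi * \<i> * zs))\<^sup>2 * A"
    unfolding \<sigma>_def power_mult_distrib power2_csqrt by (simp only: of_real_power)
  also have "\<dots> = (v\<^sup>2 * deriv (deriv H) zs) * (of_real pi * (2 * of_real pi * \<i> ^ 3 * zs ^ 2) / (2 * of_real pi * \<i> * zs)\<^sup>2)"
    by (simp add: A_def power_divide)
  also have "\<dots> = 1" unfolding v using zs by (simp add: field_simps power2_eq_square power3_eq_cube)
  finally have \<sigma>: "\<sigma> \<in> {1, -1}" by (simp add: power2_eq_1_iff)
  have "(\<lambda>t :: real. green_fun H x x' t) \<sim>[at_top]
     (\<lambda>t. exp (- \<i> * H zs * of_real t) / (\<sigma> * csqrt (A * of_real t)) * zs powi (x - x'))" for x x'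
  proof (rule asymp_equivI')
    let ?c = "\<sigma> * csqrt A / zs powi (x - x')"
    have "((\<lambda>t. (of_real (sqrt t) * exp (\<i> * H zs * of_real t) * green_fun H x x' t) * ?c) \<longlongrightarrow>
       v * of_real (sqrt pi) * (1 / (2 * of_real pi * \<i> * zs) * zs powi (x - x')) * ?c) at_top"
      by (intro tendsto_mult_right lim)
    also have "v * of_real (sqrt pi) * (1 / (2 * of_real pi * \<i> * zs) * zs powi (x - x')) * ?c = \<sigma> * \<sigma>"
      using zs by (simp add: \<sigma>_def)
    also have "\<sigma> * \<sigma> = 1" using \<sigma> by auto
    finally show "((\<lambda>t. green_fun H x x' t /
        (exp (- \<i> * H zs * of_real t) / (\<sigma> * csqrt (A * of_real t)) * zs powi (x - x'))) \<longlongrightarrow> 1) at_top"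
    proof (rule Lim_transform_eventually)
      show "eventually (\<lambda>t. (of_real (sqrt t) * exp (\<i> * H zs * of_real t) * green_fun H x x' t) * ?c =
          green_fun H x x' t / (exp (- \<i> * H zs * of_real t) / (\<sigma> * csqrt (A * of_real t)) * zs powi (x - x'))) at_top"
        using eventually_gt_at_top[of 0]
      proof eventually_elim
        case (elim t)
        have "exp (\<i> * H zs * of_real t) = 1 / exp (- \<i> * H zs * of_real t)"
          by (simp add: exp_minus inverse_eq_divide)
        then show ?case
          unfolding csqrt_mult_of_real[OF elim A0] using zs by simp
      qed
    qed
  qed
  then show ?thesis using \<sigma> unfolding A_def by blast
qed

end

section \<open>Properness of Laurent polynomials\<close>

lemma laurent_poly_inverse:
  "z \<noteq> 0 \<Longrightarrow> laurent_poly c m n (inverse z) = laurent_poly (\<lambda>i. c (- i)) n m z"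
  unfolding laurent_poly_def
  by (rule sum.reindex_bij_witness[of _ uminus uminus]) (auto simp: power_int_minus power_int_inverse)

text \<open>Divided by \<open>z ^ n\<close>, the Laurent polynomial tends to its leading
  coefficient.\<close>

lemma laurent_poly_at_infinity:
  assumes "n \<ge> 1" "c (int n) \<noteq> 0"
  shows "filterlim (laurent_poly c m n) at_infinity at_infinity"
proof -
  have lim: "((\<lambda>z. \<Sum>i\<in>{- int m..int n}. c i * z powi (i - int n)) \<longlongrightarrow>
      (\<Sum>i\<in>{- int m..int n}. if i = int n then c i else 0)) at_infinity"
  proof (rule tendsto_sum)
    fix i assume i: "i \<in> {- int m..int n}"
    show "((\<lambda>z. c i * z powi (i - int n)) \<longlongrightarrow> (if i = int n then c i else 0)) at_infinity"
    proof (cases "i = int n")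
      case False
      define j where "j = nat (int n - i)"
      have j: "i - int n = - int j" "j > 0" using False i by (auto simp: j_def)
      have "((\<lambda>z :: complex. c i * inverse z ^ j) \<longlongrightarrow> c i * 0 ^ j) at_infinity"
        by (intro tendsto_intros tendsto_inverse_0)
      moreover have "(0 :: complex) ^ j = 0" using j(2) by simp
      ultimately show ?thesis using j(1) False by (simp add: power_int_minus power_inverse)
    qed auto
  qed
  have "filterlim (\<lambda>z. (\<Sum>i\<in>{- int m..int n}. c i * z powi (i - int n)) * z ^ n) at_infinity at_infinity"
  proof (rule tendsto_mult_filterlim_at_infinity[OF lim])
    show "(\<Sum>i\<in>{- int m..int n}. if i = int n then c i else 0) \<noteq> 0" using assms by simp
    show "filterlim (\<lambda>z :: complex. z ^ n) at_infinity at_infinity"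
      by (rule filterlim_power_at_infinity) (use assms in auto)
  qed
  moreover have "eventually (\<lambda>z. (\<Sum>i\<in>{- int m..int n}. c i * z powi (i - int n)) * z ^ n = laurent_poly c m n z) at_infinity"
    using eventually_not_equal_at_infinity[of 0]
  proof eventually_elim
    case (elim z)
    have "z powi (i - int n) * z ^ n = z powi i" for i
      using elim power_int_add[of z "i - int n" "int n"] by simp
    then show ?case by (simp add: laurent_poly_def sum_distrib_right mult.assoc)
  qed
  ultimately show ?thesis by (rule filterlim_cong[OF refl refl, THEN iffD1, rotated])
qed

text \<open>The map \<open>inverse\<close> exchanges the two ends of the punctured plane and
  reverses the coefficients, so growth at infinity, applied to both polynomials, bounds
  \<open>z\<close> from above and away from 0.\<close>

lemma laurent_poly_proper:
  assumes "m \<ge> 1" "n \<ge> 1" "c (- int m) \<noteq> 0" "c (int n) \<noteq> 0"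
  shows "proper_on_punctured_plane (laurent_poly c m n)"
proof
  show "laurent_poly c m n holomorphic_on - {0}"
    unfolding laurent_poly_def[abs_def] by (intro holomorphic_intros) auto
  fix K :: real
  have *: "\<exists>R>0. \<forall>z. norm z > R \<longrightarrow> norm (laurent_poly d k l z) > K"
    if "l \<ge> 1" "d (int l) \<noteq> 0" for d k l
  proof -
    have "eventually (\<lambda>z. \<bar>K\<bar> + 1 \<le> norm (laurent_poly d k l z)) at_infinity"
      using laurent_poly_at_infinity[of l d k, OF that]
      by (simp add: filterlim_at_infinity[of 0] del: not_less)
    then obtain b where b: "\<And>z. b \<le> norm z \<Longrightarrow> \<bar>K\<bar> + 1 \<le> norm (laurent_poly d k l z)"
      unfolding eventually_at_infinity by blast
    have "norm (laurent_poly d k l z) > K" if "norm z > max b 1" for z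
      using b[of z] that by linarith
    then show ?thesis by (intro exI[of _ "max b 1"]) auto
  qed
  obtain R where R: "R > 0" "\<And>z. norm z > R \<Longrightarrow> norm (laurent_poly c m n z) > K"
    using *[of n c m] assms by auto
  obtain R' where R': "R' > 0" "\<And>z. norm z > R' \<Longrightarrow> norm (laurent_poly (\<lambda>i. c (- i)) n m z) > K"
    using *[of m "\<lambda>i. c (- i)" n] assms by auto
  have "1 / R' \<le> norm z \<and> norm z \<le> R" if z: "z \<noteq> 0" "norm (laurent_poly c m n z) \<le> K" for z
  proof
    show "norm z \<le> R" using R(2)[of z] z by linarith
    have "laurent_poly (\<lambda>i. c (- i)) n m (inverse z) = laurent_poly c m n z"
      using laurent_poly_inverse[of "inverse z" c m n] z by simp
    then have "norm (inverse z) \<le> R'" using R'(2)[of "inverse z"] z by fastforce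
    then have "inverse (norm z) \<le> R'" by (simp only: norm_inverse)
    then show "1 / R' \<le> norm z" using z R'(1) by (simp add: field_simps)
  qed
  then show "\<exists>r R. 0 < r \<and> (\<forall>z. z \<noteq> 0 \<longrightarrow> norm (laurent_poly c m n z) \<le> K \<longrightarrow> r \<le> norm z \<and> norm z \<le> R)"
    using R'(1) by (intro exI[of _ "1 / R'"] exI[of _ R]) auto
qed

theorem mainTheorem1:
  fixes m n :: nat and c :: "int \<Rightarrow> complex" and H :: "complex \<Rightarrow> complex" and zs :: complex
  assumes "m \<ge> 1" and "n \<ge> 1"
    and "c (- int m) \<noteq> 0" and "c (int n) \<noteq> 0"
    and "H = laurent_poly c m n"
    and "\<And>z. saddle_point H z \<Longrightarrow> nondegenerate H z"
    and "\<And>z z'. saddle_point H z \<Longrightarrow> saddle_point H z' \<Longrightarrow> z' \<noteq> z \<Longrightarrow>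
           \<not> ascending_curve_ends_at H z z'"
    and "unique_dominant_saddle_point H zs"
  shows "\<exists>\<sigma>\<in>{1, -1 :: complex}. \<forall>x x' :: int.
           (\<lambda>t :: real. green_fun H x x' t) \<sim>[at_top]
           (\<lambda>t. exp (- \<i> * H zs * of_real t) /
                (\<sigma> * csqrt (2 * of_real pi * \<i> ^ 3 * zs ^ 2 * deriv (deriv H) zs * of_real t)) *
                zs powi (x - x'))"
proof -
  interpret proper_on_punctured_plane H
    unfolding assms(5) by (rule laurent_poly_proper) fact+
  interpret dominant_saddle H zs
    by unfold_locales fact+
  show ?thesis by (rule green_fun_asymptotics)
qed

end
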